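(* Consider the state-space model $x_{k+1}=f_k(x_k)+q_k$, $q_k\sim\mathcal N(0,Q_k)$ $(k=1,\dots,K-1)$, $y_k=h_k(x_k)+r_k$, $r_k\sim\mathcal N(0,R_k)$ $(k=1,\dots,K)$, $x_1\sim\mathcal N(\hat x_{1\mid0},\hat P_{1\mid0})$. Let $\hat x^{(i)}_{1:K}$ be the current mean estimates and (for the IPLS) $\hat P^{(i)}_{1:K}$ the current covariance matrices. Let $\lambda^{(i)}>0$ and let $S^{(i)}=\mathrm{diag}(S^{(i)}_1,\dots,S^{(i)}_K)$ be a block-diagonal positive definite regularisation matrix with $S^{(i)}_k\in\mathbb R^{d_x\times d_x}$, $k=1,\dots,K$. Extend the state-space model, at every time step $k=1,\dots,K$, with the additional measurement $$\hat x^{(i)}_k=x_k+e_k,\qquad e_k\sim\mathcal N\big(0,(\lambda^{(i)})^{-1}S^{(i)}_k\big).$$ Then iterated smoothing of the extended model with the IEKS or with the IPLS is a Gauss--Newton method with Levenberg--Marquardt regularisation. That is, at each iteration $i$, the smoothed means produced by one iteration of the IEKS (respectively, the IPLS) applied to the extended model, linearised at the current estimates, equal the output of one Gauss--Newton iteration, started at $\hat x^{(i)}_{1:K}$, for minimising $$L^{(i)}_{\mathrm{LM}}(x_{1:K})=L(x_{1:K})+\tfrac12\lambda^{(i)}(x_{1:K}-\hat x^{(i)}_{1:K})^\top[S^{(i)}]^{-1}(x_{1:K}-\hat x^{(i)}_{1:K}),$$ where $L=L_{\mathrm{IEKS}}$ (respectively, $L=L^{(i)}_{\mathrm{IPLS}}$)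 is the cost function defined in the context.
   Context: States $x_k\in\mathbb R^{d_x}$, measurements $y_k\in\mathbb R^{d_y}$, $f_k:\mathbb R^{d_x}\to\mathbb R^{d_x}$, $h_k:\mathbb R^{d_x}\to\mathbb R^{d_y}$ (differentiable, for the IEKS); all noises, including the $e_k$, are mutually independent, white and independent of $x_1$; $x_{1:K}=(x_1,\dots,x_K)$ is identified with the stacked vector. All covariance matrices inverted below are symmetric positive definite, and all Gaussian moments below are finite (at every point $x$). Cost functions. $L_{\mathrm{IEKS}}(x_{1:K})=\frac12\big((x_1-\hat x_{1\mid0})^\top\hat P_{1\mid0}^{-1}(x_1-\hat x_{1\mid0})+\sum_{k=1}^K(y_k-h_k(x_k))^\top R_k^{-1}(y_k-h_k(x_k))+\sum_{k=1}^{K-1}(x_{k+1}-f_k(x_k))^\top Q_k^{-1}(x_{k+1}-f_k(x_k))\big)$. $L^{(i)}_{\mathrm{IPLS}}(x_{1:K})=\frac12\big((x_1-\hat x_{1\mid0})^\top\hat P_{1\mid0}^{-1}(x_1-\hat x_{1\mid0})+\sum_{k=1}^{K-1}(x_{k+1}-\bar x_k(x_k))^\top(Q_k+\Omega^{(i)}_k)^{-1}(x_{k+1}-\bar x_k(x_k))+\sum_{k=1}^K(y_k-\bar y_k(x_k))^\top(R_k+\Gamma^{(i)}_k)^{-1}(y_k-\bar y_k(x_k))\big)$. Statistical linear regression (SLR). For $x\in\mathbb R^{d_x}$, let $p(\xi)=\mathcal N(\xi;x,\hat P^{(i)}_k)$ and define $\bar x_k(x)=\int f_k(\xi)p(\xi)\,d\xi$,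 $\Psi_{f_k}(x)=\int(\xi-x)(f_k(\xi)-\bar x_k(x))^\top p(\xi)\,d\xi$, $\Phi_{f_k}(x)=\int(f_k(\xi)-\bar x_k(x))(f_k(\xi)-\bar x_k(x))^\top p(\xi)\,d\xi$, $F^{(i)}_k(x)=\Psi_{f_k}(x)^\top(\hat P^{(i)}_k)^{-1}$, $b_k(x)=\bar x_k(x)-F^{(i)}_k(x)x$, $\Omega_k(x)=\Phi_{f_k}(x)-F^{(i)}_k(x)\hat P^{(i)}_kF^{(i)}_k(x)^\top$. With $h_k$ in place of $f_k$ one defines analogously $\bar y_k(x)$, $H^{(i)}_k(x)$, $c_k(x)$, $\Gamma_k(x)$. Put $\Omega^{(i)}_k=\Omega_k(\hat x^{(i)}_k)$, $\Gamma^{(i)}_k=\Gamma_k(\hat x^{(i)}_k)$; in $L^{(i)}_{\mathrm{IPLS}}$ these and $\hat P^{(i)}_{1:K}$ are fixed and do not depend on the optimisation variable. One Gauss--Newton (GN) iteration for a cost $\frac12\|\rho(x_{1:K})\|_2^2$ started at $\hat x^{(i)}_{1:K}$ outputs the minimiser over $x_{1:K}$ of $\frac12\|\rho(\hat x^{(i)}_{1:K})+J_\rho(\hat x^{(i)}_{1:K})(x_{1:K}-\hat x^{(i)}_{1:K})\|_2^2$, with $J_\rho$ the Jacobian. The costs above are written in this form by stacking the residuals appearing in the quadratic forms, each multiplied by $A^\top$ where $AA^\top$ is the corresponding (inverse covariance) weight matrix; for $L^{(i)}_{\mathrm{LM}}$ the stacked residual also includes the term for $x_{1:K}-\hat x^{(i)}_{1:K}$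 with weight matrix $\lambda^{(i)}[S^{(i)}]^{-1}$. One iteration of an iterated smoother: the motion and measurement models are replaced by $x_{k+1}=F_kx_k+b_k+\omega_k+q_k$, $\omega_k\sim\mathcal N(0,\Omega_k)$, and $y_k=H_kx_k+c_k+\gamma_k+r_k$, $\gamma_k\sim\mathcal N(0,\Gamma_k)$, with all noises mutually independent, white and independent of $x_1$ (the additional measurement $\hat x^{(i)}_k=x_k+e_k$ is already linear and is kept as is). Then Rauch--Tung--Striebel (RTS) smoothing is applied, which computes the exact marginal posterior of each $x_k$ given all measurements in the affine Gaussian model; the smoothed means are the posterior means. In the IEKS (iterated extended Kalman smoother), $F_k=J_{f_k}(\hat x^{(i)}_k)$, $b_k=f_k(\hat x^{(i)}_k)-F_k\hat x^{(i)}_k$, $\Omega_k=0$, $H_k=J_{h_k}(\hat x^{(i)}_k)$, $c_k=h_k(\hat x^{(i)}_k)-H_k\hat x^{(i)}_k$, $\Gamma_k=0$. In the IPLS (iterated posterior linearisation smoother), $F_k=F^{(i)}_k(\hat x^{(i)}_k)$, $b_k=b_k(\hat x^{(i)}_k)$, $\Omega_k=\Omega^{(i)}_k$, $H_k=H^{(i)}_k(\hat x^{(i)}_k)$, $c_k=c_k(\hat x^{(i)}_k)$, $\Gamma_k=\Gamma^{(i)}_k$. *)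

theory Defs
  imports "HOL-Analysis.Analysis"
begin

definition spd :: "real^'n^'n \<Rightarrow> bool" where
  "spd A \<longleftrightarrow> transpose A = A \<and> (\<forall>v. v \<noteq> 0 \<longrightarrow> 0 < v \<bullet> (A *v v))"

text \<open>
  Stacked trajectories. The times 1..K are matched with a finite type \<open>'k\<close> by a bijection
  \<open>tm\<close>, so that \<open>x\<^sub>1, \<dots>, x\<^sub>K\<close> in \<open>real^'n\<close> form one vector in \<open>real^('k \<times> 'n)\<close>.
\<close>

definition block :: "(nat \<Rightarrow> 'k) \<Rightarrow> real^('k::finite \<times> 'n::finite) \<Rightarrow> nat \<Rightarrow> real^'n" where
  "block tm x k = (\<chi> j. x $ (tm k, j))"

definition stack :: "nat \<Rightarrow> (nat \<Rightarrow> 'k) \<Rightarrow> (nat \<Rightarrow> real^'n) \<Rightarrow> real^('k::finite \<times> 'n::finite)" where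
  "stack K tm v = (\<chi> p. v (the_inv_into {1..K} tm (fst p)) $ snd p)"

definition block_diag ::
  "nat \<Rightarrow> (nat \<Rightarrow> 'k) \<Rightarrow> (nat \<Rightarrow> real^'n^'n) \<Rightarrow> real^('k::finite \<times> 'n::finite)^('k \<times> 'n)" where
  "block_diag K tm S =
     (\<chi> p q. if fst p = fst q then S (the_inv_into {1..K} tm (fst p)) $ snd p $ snd q else 0)"


section \<open>Gaussian densities and laws\<close>

definition gauss_density :: "real^'n \<Rightarrow> real^'n^'n \<Rightarrow> real^'n \<Rightarrow> real" where
  "gauss_density m P \<xi> =
     exp (- (1/2) * ((\<xi> - m) \<bullet> (matrix_inv P *v (\<xi> - m)))) / sqrt ((2 * pi) ^ CARD('n) * det P)"

text \<open>
  The law N(m, P) for a symmetric positive semidefinite, possibly singular, \<open>P\<close>: the image of the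
  standard normal law under \<open>z \<mapsto> m + A z\<close>, where \<open>A A\<^sup>T = P\<close>. It does not depend on the choice of \<open>A\<close>.
\<close>

definition gauss_law :: "real^'n \<Rightarrow> real^'n^'n \<Rightarrow> (real^'n) measure" where
  "gauss_law m P =
     (let A = (SOME A :: real^'n^'n. A ** transpose A = P)
      in distr (density lborel (\<lambda>z. ennreal (gauss_density 0 (mat 1) z))) borel (\<lambda>z. m + A *v z))"

text \<open>
  The density of \<open>\<omega> + q\<close> for independent \<open>\<omega> \<sim> N(0, C)\<close> and \<open>q \<sim> N(0, B)\<close>. Only \<open>B\<close> has to be
  nonsingular.
\<close>

definition noise_density :: "real^'n^'n \<Rightarrow> real^'n^'n \<Rightarrow> real^'n \<Rightarrow> real" where
  "noise_density C B v = (\<integral>w. gauss_density 0 B (v - w) \<partial>gauss_law 0 C)"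


section \<open>Statistical linear regression\<close>

definition outer :: "real^'n \<Rightarrow> real^'m \<Rightarrow> real^'m^'n" where
  "outer u v = (\<chi> i j. u $ i * v $ j)"

definition slr_mean :: "(real^'n \<Rightarrow> real^'m) \<Rightarrow> real^'n^'n \<Rightarrow> real^'n \<Rightarrow> real^'m" where
  "slr_mean g P x = (\<integral>\<xi>. gauss_density x P \<xi> *\<^sub>R g \<xi> \<partial>lborel)"

definition slr_Psi :: "(real^'n \<Rightarrow> real^'m) \<Rightarrow> real^'n^'n \<Rightarrow> real^'n \<Rightarrow> real^'m^'n" where
  "slr_Psi g P x =
     (\<integral>\<xi>. gauss_density x P \<xi> *\<^sub>R outer (\<xi> - x) (g \<xi> - slr_mean g P x) \<partial>lborel)"

definition slr_Phi :: "(real^'n \<Rightarrow> real^'m) \<Rightarrow> real^'n^'n \<Rightarrow> real^'n \<Rightarrow> real^'m^'m" where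
  "slr_Phi g P x =
     (\<integral>\<xi>. gauss_density x P \<xi> *\<^sub>R outer (g \<xi> - slr_mean g P x) (g \<xi> - slr_mean g P x) \<partial>lborel)"

definition slr_moments_finite :: "(real^'n \<Rightarrow> real^'m) \<Rightarrow> real^'n^'n \<Rightarrow> bool" where
  "slr_moments_finite g P \<longleftrightarrow> (\<forall>x.
     integrable lborel (\<lambda>\<xi>. gauss_density x P \<xi> *\<^sub>R g \<xi>) \<and>
     integrable lborel (\<lambda>\<xi>. gauss_density x P \<xi> *\<^sub>R outer (\<xi> - x) (g \<xi> - slr_mean g P x)) \<and>
     integrable lborel
       (\<lambda>\<xi>. gauss_density x P \<xi> *\<^sub>R outer (g \<xi> - slr_mean g P x) (g \<xi> - slr_mean g P x)))"

definition slr_mat :: "(real^'n \<Rightarrow> real^'m) \<Rightarrow> real^'n^'n \<Rightarrow> real^'n \<Rightarrow> real^'n^'m" where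
  "slr_mat g P x = transpose (slr_Psi g P x) ** matrix_inv P"

definition slr_offset :: "(real^'n \<Rightarrow> real^'m) \<Rightarrow> real^'n^'n \<Rightarrow> real^'n \<Rightarrow> real^'m" where
  "slr_offset g P x = slr_mean g P x - slr_mat g P x *v x"

definition slr_cov :: "(real^'n \<Rightarrow> real^'m) \<Rightarrow> real^'n^'n \<Rightarrow> real^'n \<Rightarrow> real^'m^'m" where
  "slr_cov g P x = slr_Phi g P x - slr_mat g P x ** P ** transpose (slr_mat g P x)"


section \<open>State-space models and their linearisations\<close>

record ('dx, 'dy) ssm =
  motion :: "nat \<Rightarrow> real^'dx::finite \<Rightarrow> real^'dx"
  obs :: "nat \<Rightarrow> real^'dx \<Rightarrow> real^'dy::finite"
  motion_cov :: "nat \<Rightarrow> real^'dx^'dx"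
  obs_cov :: "nat \<Rightarrow> real^'dy^'dy"
  init_mean :: "real^'dx"
  init_cov :: "real^'dx^'dx"

text \<open>
  The affine surrogate x(k+1) = F(k) x(k) + b(k) + \<open>\<omega>\<close>(k) + q(k), y(k) = H(k) x(k) + c(k) + \<open>\<gamma>\<close>(k) + r(k), where
  \<open>\<omega>\<close>(k) and \<open>\<gamma>\<close>(k) have the covariances \<open>lin_Omega\<close> k and \<open>lin_Gamma\<close> k.
\<close>

record ('dx, 'dy) linearisation =
  lin_F :: "nat \<Rightarrow> real^'dx::finite^'dx"
  lin_b :: "nat \<Rightarrow> real^'dx"
  lin_Omega :: "nat \<Rightarrow> real^'dx^'dx"
  lin_H :: "nat \<Rightarrow> real^'dx^'dy::finite"
  lin_c :: "nat \<Rightarrow> real^'dy"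
  lin_Gamma :: "nat \<Rightarrow> real^'dy^'dy"

definition ieks_linearisation ::
  "('dx::finite, 'dy::finite) ssm \<Rightarrow> (nat \<Rightarrow> real^'dx) \<Rightarrow> ('dx, 'dy) linearisation" where
  "ieks_linearisation M xh =
    \<lparr> lin_F = (\<lambda>k. jacobian (motion M k) (at (xh k))),
      lin_b = (\<lambda>k. motion M k (xh k) - jacobian (motion M k) (at (xh k)) *v xh k),
      lin_Omega = (\<lambda>k. 0),
      lin_H = (\<lambda>k. jacobian (obs M k) (at (xh k))),
      lin_c = (\<lambda>k. obs M k (xh k) - jacobian (obs M k) (at (xh k)) *v xh k),
      lin_Gamma = (\<lambda>k. 0) \<rparr>"

definition ipls_linearisation ::
  "('dx::finite, 'dy::finite) ssm \<Rightarrow> (nat \<Rightarrow> real^'dx) \<Rightarrow> (nat \<Rightarrow> real^'dx^'dx)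
    \<Rightarrow> ('dx, 'dy) linearisation" where
  "ipls_linearisation M xh Ph =
    \<lparr> lin_F = (\<lambda>k. slr_mat (motion M k) (Ph k) (xh k)),
      lin_b = (\<lambda>k. slr_offset (motion M k) (Ph k) (xh k)),
      lin_Omega = (\<lambda>k. slr_cov (motion M k) (Ph k) (xh k)),
      lin_H = (\<lambda>k. slr_mat (obs M k) (Ph k) (xh k)),
      lin_c = (\<lambda>k. slr_offset (obs M k) (Ph k) (xh k)),
      lin_Gamma = (\<lambda>k. slr_cov (obs M k) (Ph k) (xh k)) \<rparr>"


section \<open>Smoothing of the extended affine model\<close>

text \<open>
  Joint density at a trajectory \<open>x\<close>, the measurements \<open>y\<close>, and the additional measurements
  z(k) = x(k) + e(k) with e(k) distributed as N(0, E(k)). The noises being mutually independent,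
  white and independent of x(1), it is the product of the prior of x(1), the transition
  densities and the likelihoods.
\<close>

definition joint_density ::
  "nat \<Rightarrow> (nat \<Rightarrow> 'k) \<Rightarrow> ('dx::finite, 'dy::finite) ssm \<Rightarrow> ('dx, 'dy) linearisation
    \<Rightarrow> (nat \<Rightarrow> real^'dx^'dx) \<Rightarrow> (nat \<Rightarrow> real^'dy) \<Rightarrow> (nat \<Rightarrow> real^'dx)
    \<Rightarrow> real^('k::finite \<times> 'dx) \<Rightarrow> real" where
  "joint_density K tm M A E y z x =
     gauss_density (init_mean M) (init_cov M) (block tm x 1)
     * (\<Prod>k\<in>{1..<K}. noise_density (lin_Omega A k) (motion_cov M k)
          (block tm x (k + 1) - (lin_F A k *v block tm x k + lin_b A k)))
     * (\<Prod>k\<in>{1..K}. noise_density (lin_Gamma A k) (obs_cov M k)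
          (y k - (lin_H A k *v block tm x k + lin_c A k)))
     * (\<Prod>k\<in>{1..K}. gauss_density 0 (E k) (z k - block tm x k))"

definition posterior ::
  "nat \<Rightarrow> (nat \<Rightarrow> 'k) \<Rightarrow> ('dx::finite, 'dy::finite) ssm \<Rightarrow> ('dx, 'dy) linearisation
    \<Rightarrow> (nat \<Rightarrow> real^'dx^'dx) \<Rightarrow> (nat \<Rightarrow> real^'dy) \<Rightarrow> (nat \<Rightarrow> real^'dx)
    \<Rightarrow> (real^('k::finite \<times> 'dx)) measure" where
  "posterior K tm M A E y z =
     density lborel (\<lambda>x. ennreal (joint_density K tm M A E y z x
                                / (\<integral>x'. joint_density K tm M A E y z x' \<partial>lborel)))"

definition smoothed_marginal ::
  "nat \<Rightarrow> (nat \<Rightarrow> 'k::finite) \<Rightarrow> ('dx::finite, 'dy::finite) ssm \<Rightarrow> ('dx, 'dy) linearisation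
    \<Rightarrow> (nat \<Rightarrow> real^'dx^'dx) \<Rightarrow> (nat \<Rightarrow> real^'dy) \<Rightarrow> (nat \<Rightarrow> real^'dx)
    \<Rightarrow> nat \<Rightarrow> (real^'dx) measure" where
  "smoothed_marginal K tm M A E y z k =
     distr (posterior K tm M A E y z) borel (\<lambda>x. block tm x k)"

definition smoothed_mean ::
  "nat \<Rightarrow> (nat \<Rightarrow> 'k::finite) \<Rightarrow> ('dx::finite, 'dy::finite) ssm \<Rightarrow> ('dx, 'dy) linearisation
    \<Rightarrow> (nat \<Rightarrow> real^'dx^'dx) \<Rightarrow> (nat \<Rightarrow> real^'dy) \<Rightarrow> (nat \<Rightarrow> real^'dx)
    \<Rightarrow> nat \<Rightarrow> real^'dx" where
  "smoothed_mean K tm M A E y z k = (\<integral>\<xi>. \<xi> \<partial>smoothed_marginal K tm M A E y z k)"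

text \<open>
  One iteration for the model extended by \<open>xh k = x(k) + e(k)\<close>, where e(k) has the covariance
  \<open>(1 / lam) S k\<close>. The estimates \<open>xh\<close> enter both as the linearisation points and as the values of
  the additional measurements.
\<close>

definition ieks_means ::
  "nat \<Rightarrow> (nat \<Rightarrow> 'k) \<Rightarrow> ('dx::finite, 'dy::finite) ssm \<Rightarrow> (nat \<Rightarrow> real^'dy) \<Rightarrow> real
    \<Rightarrow> (nat \<Rightarrow> real^'dx^'dx) \<Rightarrow> real^('k::finite \<times> 'dx) \<Rightarrow> real^('k \<times> 'dx)" where
  "ieks_means K tm M y lam S xh =
     stack K tm (smoothed_mean K tm M (ieks_linearisation M (block tm xh))
                   (\<lambda>k. (1 / lam) *\<^sub>R S k) y (block tm xh))"

definition ipls_means ::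
  "nat \<Rightarrow> (nat \<Rightarrow> 'k) \<Rightarrow> ('dx::finite, 'dy::finite) ssm \<Rightarrow> (nat \<Rightarrow> real^'dy) \<Rightarrow> real
    \<Rightarrow> (nat \<Rightarrow> real^'dx^'dx) \<Rightarrow> real^('k::finite \<times> 'dx) \<Rightarrow> (nat \<Rightarrow> real^'dx^'dx)
    \<Rightarrow> real^('k \<times> 'dx)" where
  "ipls_means K tm M y lam S xh Ph =
     stack K tm (smoothed_mean K tm M (ipls_linearisation M (block tm xh) Ph)
                   (\<lambda>k. (1 / lam) *\<^sub>R S k) y (block tm xh))"


section \<open>Cost functions and residuals\<close>

text \<open>\<open>u k\<close> and \<open>v k\<close> predict x(k+1) and y(k) from x(k); \<open>Qc k\<close> and \<open>Rc k\<close> are the covariances.\<close>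

definition smoothing_cost ::
  "nat \<Rightarrow> (nat \<Rightarrow> 'k) \<Rightarrow> real^'dx \<Rightarrow> real^'dx^'dx
    \<Rightarrow> (nat \<Rightarrow> real^'dx \<Rightarrow> real^'dx) \<Rightarrow> (nat \<Rightarrow> real^'dx^'dx)
    \<Rightarrow> (nat \<Rightarrow> real^'dx \<Rightarrow> real^'dy) \<Rightarrow> (nat \<Rightarrow> real^'dy^'dy)
    \<Rightarrow> (nat \<Rightarrow> real^'dy) \<Rightarrow> real^('k::finite \<times> 'dx::finite) \<Rightarrow> real" where
  "smoothing_cost K tm m0 P0 u Qc v Rc y x = 1/2 *
     ((block tm x 1 - m0) \<bullet> (matrix_inv P0 *v (block tm x 1 - m0))
      + (\<Sum>k\<in>{1..K}. (y k - v k (block tm x k)) \<bullet>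
           (matrix_inv (Rc k) *v (y k - v k (block tm x k))))
      + (\<Sum>k\<in>{1..<K}. (block tm x (k + 1) - u k (block tm x k)) \<bullet>
           (matrix_inv (Qc k) *v (block tm x (k + 1) - u k (block tm x k)))))"

definition L_IEKS ::
  "nat \<Rightarrow> (nat \<Rightarrow> 'k) \<Rightarrow> ('dx::finite, 'dy::finite) ssm \<Rightarrow> (nat \<Rightarrow> real^'dy)
    \<Rightarrow> real^('k::finite \<times> 'dx) \<Rightarrow> real" where
  "L_IEKS K tm M y =
     smoothing_cost K tm (init_mean M) (init_cov M) (motion M) (motion_cov M) (obs M) (obs_cov M) y"

text \<open>The covariances are evaluated at the fixed estimates \<open>xh\<close>, the means at the variable.\<close>

definition L_IPLS ::
  "nat \<Rightarrow> (nat \<Rightarrow> 'k) \<Rightarrow> ('dx::finite, 'dy::finite) ssm \<Rightarrow> (nat \<Rightarrow> real^'dy)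
    \<Rightarrow> real^('k::finite \<times> 'dx) \<Rightarrow> (nat \<Rightarrow> real^'dx^'dx) \<Rightarrow> real^('k \<times> 'dx) \<Rightarrow> real" where
  "L_IPLS K tm M y xh Ph =
     smoothing_cost K tm (init_mean M) (init_cov M)
       (\<lambda>k. slr_mean (motion M k) (Ph k))
       (\<lambda>k. motion_cov M k + slr_cov (motion M k) (Ph k) (block tm xh k))
       (\<lambda>k. slr_mean (obs M k) (Ph k))
       (\<lambda>k. obs_cov M k + slr_cov (obs M k) (Ph k) (block tm xh k)) y"

definition L_LM ::
  "nat \<Rightarrow> (nat \<Rightarrow> 'k) \<Rightarrow> (real^('k::finite \<times> 'dx::finite) \<Rightarrow> real) \<Rightarrow> real
    \<Rightarrow> (nat \<Rightarrow> real^'dx^'dx) \<Rightarrow> real^('k \<times> 'dx) \<Rightarrow> real^('k \<times> 'dx) \<Rightarrow> real" where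
  "L_LM K tm L lam S xh x =
     L x + 1/2 * lam * ((x - xh) \<bullet> (matrix_inv (block_diag K tm S) *v (x - xh)))"

text \<open>
  The stacked residual, each part multiplied by the transpose of its weight factor. There are only
  K - 1 motion residuals; the K-th slot of the motion part is padded with 0, which changes neither
  the norm nor the minimisers.
\<close>

definition lm_residual ::
  "nat \<Rightarrow> (nat \<Rightarrow> 'k) \<Rightarrow> real^'dx \<Rightarrow> real^'dx^'dx
    \<Rightarrow> (nat \<Rightarrow> real^'dx \<Rightarrow> real^'dx) \<Rightarrow> (nat \<Rightarrow> real^'dx^'dx)
    \<Rightarrow> (nat \<Rightarrow> real^'dx \<Rightarrow> real^'dy) \<Rightarrow> (nat \<Rightarrow> real^'dy^'dy)
    \<Rightarrow> (nat \<Rightarrow> real^'dy) \<Rightarrow> real^('k \<times> 'dx)^('k \<times> 'dx) \<Rightarrow> real^('k \<times> 'dx)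
    \<Rightarrow> real^('k::finite \<times> 'dx::finite)
    \<Rightarrow> (real^'dx) \<times> (real^('k \<times> 'dx)) \<times> (real^('k \<times> 'dy::finite)) \<times> (real^('k \<times> 'dx))" where
  "lm_residual K tm m0 W0 u WQ v WR y WS xh x =
     (transpose W0 *v (block tm x 1 - m0),
      stack K tm (\<lambda>k. if k < K
        then transpose (WQ k) *v (block tm x (k + 1) - u k (block tm x k)) else 0),
      stack K tm (\<lambda>k. transpose (WR k) *v (y k - v k (block tm x k))),
      transpose WS *v (x - xh))"


section \<open>Gauss--Newton\<close>

text \<open>
  \<open>z\<close> is the output of one iteration for the cost \<open>L\<close>, written as half the squared norm of \<open>\<rho>\<close>,
  started at \<open>x0\<close>: it is the unique minimiser of the cost with \<open>\<rho>\<close> linearised at \<open>x0\<close>.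
\<close>

definition gn_model :: "('a::euclidean_space \<Rightarrow> 'b::euclidean_space) \<Rightarrow> 'a \<Rightarrow> 'a \<Rightarrow> real" where
  "gn_model \<rho> x0 x = 1/2 * (norm (\<rho> x0 + frechet_derivative \<rho> (at x0) (x - x0)))\<^sup>2"

definition gauss_newton_output ::
  "('a::euclidean_space \<Rightarrow> real) \<Rightarrow> ('a \<Rightarrow> 'b::euclidean_space) \<Rightarrow> 'a \<Rightarrow> 'a \<Rightarrow> bool" where
  "gauss_newton_output L \<rho> x0 z \<longleftrightarrow>
     (\<forall>x. L x = 1/2 * (norm (\<rho> x))\<^sup>2) \<and>
     \<rho> differentiable (at x0) \<and>
     (\<forall>x. x \<noteq> z \<longrightarrow> gn_model \<rho> x0 z < gn_model \<rho> x0 x)"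

end

(*
  In the linearised model the sum of the two independent noises of a step is Gaussian with the summed
  covariance, so the joint density at a trajectory x is a constant times exp(-m(x)), where m is the
  smoothing cost with affine predictions plus the regularisation term contributed by the additional
  measurements. The affine predictions are the first-order expansions at the current estimates of the
  predictions in the cost: for the IEKS by definition, for the IPLS because the derivative of
  x |-> E f(xi), xi ~ N(x, P), is the regression matrix Psi^T P^-1. Hence m is the Gauss-Newton model.
  The regularisation term makes it strictly convex, and the posterior, a Gaussian centred at its
  minimiser, has that minimiser as its mean.
*)

theory Submission
  imports Defs "HOL-Probability.Distributions"
begin

section \<open>Symmetric positive definite matrices\<close>

text \<open>Two obstacles shape the proof. The surrogate covariances \<open>lin_Omega\<close> and
  \<open>lin_Gamma\<close> may be singular (they vanish for the IEKS), so their laws need not have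
  densities. \<open>gauss_law\<close> therefore pushes a standard normal forward by a root of the
  covariance, which calls for a root of every positive semidefinite matrix and for semidefiniteness
  of \<open>slr_cov\<close>, a difference of two matrices. Secondly, the functions regressed by the
  IPLS may be rough, so the derivative of \<open>slr_mean\<close> has to fall on the Gaussian
  weight. Shifting the mean of that weight by h multiplies it by an exponential linear in the
  integration variable, up to a factor depending on h alone. Differentiation thus becomes that of a
  Laplace transform at 0, and integrability at every mean x supplies the domination. The weight
  factors are arbitrary solutions of W W^T = weight, so no particular square root may be used. The
  centre of the posterior comes from an orthogonal projection rather than from solving normal
  equations.\<close>

declare transpose_matrix_vector [simp del]

lemma dot_transpose: "(A *v x) \<bullet> y = x \<bullet> (transpose A *v y)" for A :: "real^'n^'m"
  by (metis dot_lmul_matrix inner_commute transpose_matrix_vector transpose_transpose)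

lemma matrix_inv_mult:
  fixes A :: "real^'n^'n"
  assumes "invertible A"
  shows "A ** matrix_inv A = mat 1" "matrix_inv A ** A = mat 1"
  using assms unfolding invertible_def matrix_inv_def by (metis (mono_tags, lifting) someI_ex)+

lemma matrix_inv_unique:
  fixes A :: "real^'n^'n"
  assumes "A ** B = mat 1"
  shows "matrix_inv A = B"
proof -
  have "invertible A" using assms invertible_right_inverse by blast
  then have "matrix_inv A = matrix_inv A ** (A ** B)" by (simp add: assms)
  also have "\<dots> = B"
    using \<open>invertible A\<close> by (simp add: matrix_mul_assoc matrix_inv_mult)
  finally show ?thesis .
qed

lemma transpose_add: "transpose (A + B) = transpose A + transpose B"
  by (simp add: transpose_def vec_eq_iff)

text \<open>The surrogate covariances fall in this class: zero for the IEKS, possibly degenerate for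
  the IPLS. They are sure to be invertible only after a noise covariance is added.\<close>

definition psd :: "real^'n^'n \<Rightarrow> bool" where
  "psd A \<longleftrightarrow> transpose A = A \<and> (\<forall>v. 0 \<le> v \<bullet> (A *v v))"

lemma spd_imp_psd: "spd A \<Longrightarrow> psd A"
  unfolding spd_def psd_def by (metis inner_zero_left less_eq_real_def)

lemma psd_zero: "psd 0"
  by (simp add: psd_def transpose_def vec_eq_iff)

lemma spd_add_psd: "spd B \<Longrightarrow> psd C \<Longrightarrow> spd (B + C)"
  unfolding spd_def psd_def
  by (simp add: transpose_add matrix_vector_mult_add_rdistrib inner_right_distrib add_pos_nonneg)

lemma spd_mat_1: "spd (mat 1)"
  by (simp add: spd_def transpose_mat)

lemma spd_scaleR: "c > 0 \<Longrightarrow> spd A \<Longrightarrow> spd (c *\<^sub>R A)"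
  unfolding spd_def by (simp add: transpose_scalar flip: scaleR_matrix_vector_assoc)

lemma spd_invertible:
  assumes "spd A"
  shows "invertible A"
proof -
  have "x = 0" if "A *v x = 0" for x
    using assms that unfolding spd_def by (metis inner_zero_right less_irrefl)
  then show ?thesis
    by (simp add: invertible_left_inverse matrix_left_invertible_ker)
qed

lemmas spd_inv_mult = matrix_inv_mult[OF spd_invertible]

lemma spd_inv_vec:
  assumes "spd A"
  shows "A *v (matrix_inv A *v x) = x" "matrix_inv A *v (A *v x) = x"
  using spd_inv_mult[OF assms] by (simp_all add: matrix_vector_mul_assoc)

text \<open>With w = A^-1 v, the form of the inverse at v is the form of A at w, and w is nonzero
  when v is.\<close>

lemma spd_matrix_inv:
  fixes A :: "real^'n^'n"
  assumes "spd A"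
  shows "spd (matrix_inv A)"
  unfolding spd_def
proof (intro conjI allI impI)
  have "A ** transpose (matrix_inv A) = mat 1"
  proof -
    have "transpose (matrix_inv A ** A) = mat 1"
      by (simp add: spd_inv_mult assms transpose_mat)
    then show ?thesis
      using assms by (simp add: matrix_transpose_mul spd_def)
  qed
  then show "transpose (matrix_inv A) = matrix_inv A"
    by (rule matrix_inv_unique[symmetric])
  fix v :: "real^'n"
  assume "v \<noteq> 0"
  then have "matrix_inv A *v v \<noteq> 0"
    using spd_inv_vec[OF assms] by (metis matrix_vector_mult_0_right)
  then show "0 < v \<bullet> (matrix_inv A *v v)"
    using assms spd_inv_vec(1)[OF assms, of v] unfolding spd_def by (metis inner_commute)
qed

lemma matrix_inv_scaleR:
  assumes "spd A" "c \<noteq> 0"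
  shows "matrix_inv (c *\<^sub>R A) = (1 / c) *\<^sub>R matrix_inv A"
proof (rule matrix_inv_unique)
  have "(c *\<^sub>R A) ** ((1 / c) *\<^sub>R matrix_inv A) = (1 / c) *\<^sub>R (c *\<^sub>R (A ** matrix_inv A))"
    by (simp only: matrix_scalar_ac scalar_matrix_assoc)
  then show "(c *\<^sub>R A) ** ((1 / c) *\<^sub>R matrix_inv A) = mat 1"
    using assms by (simp add: spd_inv_mult)
qed

section \<open>Semidefinite forms, matrix roots and determinants\<close>

lemma inner_axis_matrix: "axis i 1 \<bullet> (A *v axis j 1) = A $ i $ j" for A :: "real^'n^'m"
  by (simp add: inner_axis' matrix_vector_mult_basis column_def)

lemma psd_nth_sym: "psd A \<Longrightarrow> A $ i $ j = A $ j $ i"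
  by (simp add: psd_def transpose_def vec_eq_iff)

lemma psd_diag_nonneg: "psd A \<Longrightarrow> 0 \<le> A $ i $ i"
  using inner_axis_matrix[of i A i] by (auto simp: psd_def dest: spec[of _ "axis i 1"])

text \<open>The form is nonnegative at every combination s x + t y; a suitable choice of s and t
  yields the discriminant inequality, with a separate choice when the form vanishes at y.\<close>

lemma psd_cauchy:
  assumes "psd A"
  shows "(x \<bullet> (A *v y))\<^sup>2 \<le> (x \<bullet> (A *v x)) * (y \<bullet> (A *v y))"
proof -
  define a b c where "a = x \<bullet> (A *v x)" and "b = x \<bullet> (A *v y)" and "c = y \<bullet> (A *v y)"
  have sym: "y \<bullet> (A *v x) = b"
    using assms unfolding b_def psd_def by (metis dot_transpose inner_commute)
  have quad: "0 \<le> a * s\<^sup>2 + 2 * s * t * b + c * t\<^sup>2" for s t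
  proof -
    have "0 \<le> (s *\<^sub>R x + t *\<^sub>R y) \<bullet> (A *v (s *\<^sub>R x + t *\<^sub>R y))"
      using assms unfolding psd_def by blast
    also have "\<dots> = a * s\<^sup>2 + 2 * s * t * b + c * t\<^sup>2"
      using sym by (simp add: matrix_vector_right_distrib matrix_vector_mult_scaleR inner_simps
          a_def b_def c_def power2_eq_square algebra_simps)
    finally show ?thesis .
  qed
  have "b\<^sup>2 \<le> a * c"
  proof (cases "c = 0")
    case True
    have "b = 0"
    proof (rule ccontr)
      assume "b \<noteq> 0"
      \<comment> \<open>With c = 0 and s = 1 the quadratic is affine in t, and this t gives it the
        value -1.\<close>
      then show False
        using quad[of 1 "- (a + 1) / (2 * b)"] True by (simp add: field_simps)
    qed
    then show ?thesis using True by simp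
  next
    case False
    have "0 \<le> c" using assms unfolding c_def psd_def by blast
    with False have "c > 0" by simp
    \<comment> \<open>The choice s = c, t = -b makes the quadratic equal to c (a c - b^2).\<close>
    have "0 \<le> c * (a * c - b\<^sup>2)"
      using quad[of c "-b"] by (simp add: power2_eq_square algebra_simps)
    then show ?thesis using \<open>c > 0\<close> by (simp add: zero_le_mult_iff)
  qed
  then show ?thesis by (simp add: a_def b_def c_def)
qed

text \<open>Cholesky: subtracting the rank-one matrix built from a row clears that row and keeps the cleared ones.\<close>

lemma psd_sum_rank_one:
  fixes A :: "real^'n^'n"
  assumes "finite I" "psd A" "\<And>i j. i \<notin> I \<Longrightarrow> A $ i $ j = 0"
  shows "\<exists>b. \<forall>i j. A $ i $ j = (\<Sum>k\<in>I. b k $ i * b k $ j)"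
  using assms
proof (induction I arbitrary: A rule: finite_induct)
  case empty
  then show ?case by simp
next
  case (insert k I)
  have sym: "A $ i $ j = A $ j $ i" for i j
    using psd_nth_sym[OF insert.prems(1)] .
  define u where "u = A *v axis k 1"
  have u: "u $ i = A $ i $ k" for i
    by (simp add: u_def matrix_vector_mult_basis column_def)
  define d where "d = A $ k $ k"
  have "d \<ge> 0"
    using psd_diag_nonneg insert.prems(1) unfolding d_def by blast
  \<comment> \<open>By Cauchy-Schwarz a zero pivot kills its whole column. Then \<open>A'\<close>
    equals \<open>A\<close>, and division by zero yielding 0 lets the formulas for \<open>A'\<close>
    and \<open>b'\<close> cover this case too.\<close>
  have u0: "u = 0" if "d = 0"
  proof -
    have "(axis i 1 \<bullet> (A *v axis k 1))\<^sup>2 \<le> (axis i 1 \<bullet> (A *v axis i 1)) * 0" for i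
      using psd_cauchy[OF insert.prems(1), of "axis i 1" "axis k 1"] that
      by (simp add: inner_axis_matrix d_def)
    then show ?thesis
      by (simp add: vec_eq_iff u inner_axis_matrix)
  qed
  define A' :: "real^'n^'n" where "A' = (\<chi> i j. A $ i $ j - u $ i * u $ j / d)"
  have quad: "v \<bullet> (A' *v v) = v \<bullet> (A *v v) - (v \<bullet> u)\<^sup>2 / d" for v
  proof -
    have "A' *v v = A *v v - ((u \<bullet> v) / d) *\<^sub>R u"
      by (simp add: A'_def vec_eq_iff matrix_vector_mult_def inner_vec_def algebra_simps
          sum_subtractf sum_divide_distrib sum_distrib_left)
    then show ?thesis
      by (simp add: inner_diff_right power2_eq_square inner_commute)
  qed
  have "psd A'"
    unfolding psd_def
  proof (intro conjI allI)
    show "transpose A' = A'"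
      using sym by (simp add: A'_def transpose_def vec_eq_iff)
    fix v
    \<comment> \<open>Cauchy-Schwarz against the unit vector of the pivot is exactly nonnegativity
      of the Schur complement.\<close>
    have "(v \<bullet> u)\<^sup>2 \<le> (v \<bullet> (A *v v)) * d"
      using psd_cauchy[OF insert.prems(1), of v "axis k 1"] by (simp add: u_def d_def inner_axis_matrix)
    then show "0 \<le> v \<bullet> (A' *v v)"
      using \<open>d \<ge> 0\<close> insert.prems(1) unfolding quad psd_def by (cases "d = 0") (auto simp: field_simps)
  qed
  moreover have "A' $ i $ j = 0" if "i \<notin> I" for i j
  proof (cases "i = k")
    case True
    then show ?thesis
      using u0 u[of j] sym[of k j] by (cases "d = 0") (auto simp: A'_def u d_def vec_eq_iff)
  next
    case False
    then show ?thesis using insert.prems(2)[of i] that by (simp add: A'_def u)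
  qed
  ultimately obtain b where b: "\<And>i j. A' $ i $ j = (\<Sum>k\<in>I. b k $ i * b k $ j)"
    using insert.IH[of A'] by blast
  define b' where "b' = b(k := (1 / sqrt d) *\<^sub>R u)"
  have "A $ i $ j = (\<Sum>k\<in>insert k I. b' k $ i * b' k $ j)" for i j
  proof -
    have "(\<Sum>l\<in>I. b' l $ i * b' l $ j) = A' $ i $ j"
      unfolding b b'_def using insert.hyps by (intro sum.cong) auto
    moreover have "b' k $ i * b' k $ j = u $ i * u $ j / d"
      using \<open>d \<ge> 0\<close> by (simp add: b'_def)
    ultimately show ?thesis
      using insert.hyps by (simp add: A'_def)
  qed
  then show ?case by blast
qed

text \<open>The vectors of the rank-one sum become the columns of the root. Its existence is what
  gives the choice in \<open>gauss_law\<close> its meaning.\<close>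

lemma psd_root:
  fixes A :: "real^'n^'n"
  assumes "psd A"
  shows "\<exists>B :: real^'n^'n. B ** transpose B = A"
proof -
  obtain b :: "'n \<Rightarrow> real^'n" where b: "\<And>i j. A $ i $ j = (\<Sum>k\<in>UNIV. b k $ i * b k $ j)"
    using psd_sum_rank_one[OF finite_class.finite_UNIV assms] by auto
  have "(\<chi> i k. b k $ i) ** transpose (\<chi> i k. b k $ i) = A"
    by (simp add: matrix_matrix_mult_def transpose_def vec_eq_iff b)
  then show ?thesis ..
qed

lemma root_norm: "B ** transpose B = A \<Longrightarrow> x \<bullet> (A *v x) = (norm (transpose B *v x))\<^sup>2"
  for B :: "real^'n^'m"
  using dot_transpose[of "transpose B" x "transpose B *v x"]
  by (auto simp: power2_norm_eq_inner matrix_vector_mul_assoc)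

text \<open>Through a root the determinant is a square, and invertibility makes it nonzero.\<close>

lemma spd_det_pos:
  fixes A :: "real^'n^'n"
  assumes "spd A"
  shows "det A > 0"
proof -
  obtain B :: "real^'n^'n" where "B ** transpose B = A" using psd_root spd_imp_psd assms by blast
  then have "det A = (det B)\<^sup>2" by (auto simp: det_mul power2_eq_square)
  moreover have "det A \<noteq> 0" using spd_invertible[OF assms] invertible_det_nz by blast
  ultimately show ?thesis by simp
qed

text \<open>The transposed root has the left inverse \<open>matrix_inv A ** B\<close>, so it is
  bounded below, and its squared norm is the form of A.\<close>

lemma spd_lower_bound:
  fixes A :: "real^'n^'n"
  assumes "spd A"
  obtains c where "c > 0" "\<And>x. c * (norm x)\<^sup>2 \<le> x \<bullet> (A *v x)"
proof -
  obtain B :: "real^'n^'n" where B: "B ** transpose B = A" using psd_root spd_imp_psd assms by blast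
  have "inj ((*v) (transpose B))"
  proof -
    have "(matrix_inv A ** B) ** transpose B = mat 1"
      by (simp add: B spd_inv_mult assms flip: matrix_mul_assoc)
    then show ?thesis
      using matrix_left_invertible_injective by blast
  qed
  then obtain c where c: "c > 0" "\<And>x. c * norm x \<le> norm (transpose B *v x)"
    using linear_inj_bounded_below_pos[of "(*v) (transpose B)"] by auto
  have "c\<^sup>2 * (norm x)\<^sup>2 \<le> x \<bullet> (A *v x)" for x
    using c power_mono[OF c(2)[of x], of 2] by (simp add: root_norm[OF B] power_mult_distrib)
  then show ?thesis using that[of "c\<^sup>2"] c(1) by simp
qed

section \<open>Gaussian integrals\<close>

lemma Basis_real_vec: "(Basis :: (real^'n) set) = range (\<lambda>i. axis i 1)"
  by (auto simp: Basis_vec_def)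

text \<open>Since a has no component along e, the map translates the coordinate along e by a
  constant once the other coordinates are fixed. Fubini with that coordinate innermost reduces the
  claim to the line.\<close>

lemma nn_integral_shear:
  fixes e a :: "'a::euclidean_space"
  assumes e: "e \<in> Basis" and a: "a \<bullet> e = 0" and f[measurable]: "f \<in> borel_measurable borel"
  shows "(\<integral>\<^sup>+x. f (x + (a \<bullet> x) *\<^sub>R e) \<partial>lborel) = (\<integral>\<^sup>+x. f x \<partial>lborel)"
proof -
  interpret P: product_sigma_finite "\<lambda>_::'a. lborel :: real measure"
    by unfold_locales
  define B' where "B' = (Basis - {e} :: 'a set)"
  have B': "Basis = insert e B'" "finite B'" "e \<notin> B'"
    using e by (auto simp: B'_def)
  define G where "G g = (\<Sum>b\<in>B'. g b *\<^sub>R b)" for g :: "'a \<Rightarrow> real"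
  have upd: "(\<Sum>b\<in>Basis. (g(e := t)) b *\<^sub>R b) = t *\<^sub>R e + G g" for g t
  proof -
    have "(\<Sum>b\<in>B'. (g(e := t)) b *\<^sub>R b) = G g"
      unfolding G_def using B'(3) by (intro sum.cong) auto
    then show ?thesis unfolding B'(1) sum.insert[OF B'(2,3)] by simp
  qed
  have fubini: "(\<integral>\<^sup>+x. h x \<partial>lborel) =
      (\<integral>\<^sup>+g. (\<integral>\<^sup>+t. h (t *\<^sub>R e + G g) \<partial>lborel) \<partial>(\<Pi>\<^sub>M b\<in>B'. lborel))"
    if [measurable]: "h \<in> borel_measurable borel" for h :: "'a \<Rightarrow> ennreal"
  proof -
    have "(\<integral>\<^sup>+x. h x \<partial>lborel)
        = (\<integral>\<^sup>+g. h (\<Sum>b\<in>Basis. g b *\<^sub>R b) \<partial>(\<Pi>\<^sub>M b\<in>(Basis::'a set). lborel))"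
      by (subst lborel_eq) (simp add: nn_integral_distr)
    also have "\<dots> = (\<integral>\<^sup>+g. (\<integral>\<^sup>+t. h (\<Sum>b\<in>Basis. (g(e := t)) b *\<^sub>R b) \<partial>lborel) \<partial>(\<Pi>\<^sub>M b\<in>B'. lborel))"
    proof -
      have "(\<lambda>g. h (\<Sum>b\<in>Basis. g b *\<^sub>R b)) \<in> borel_measurable (\<Pi>\<^sub>M b\<in>(Basis::'a set). lborel)"
        by measurable
      then show ?thesis
        using P.product_nn_integral_insert[OF B'(2,3), of "\<lambda>g. h (\<Sum>b\<in>Basis. g b *\<^sub>R b)"]
        by (simp add: B'(1))
    qed
    finally show ?thesis by (simp only: upd)
  qed
  have "(\<integral>\<^sup>+t. f ((t *\<^sub>R e + G g) + (a \<bullet> (t *\<^sub>R e + G g)) *\<^sub>R e) \<partial>lborel)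
      = (\<integral>\<^sup>+t. f (t *\<^sub>R e + G g) \<partial>lborel)" for g
  proof -
    have "(\<integral>\<^sup>+t. f (t *\<^sub>R e + G g) \<partial>lborel) = (\<integral>\<^sup>+t. f ((a \<bullet> G g + 1 * t) *\<^sub>R e + G g) \<partial>lborel)"
      by (subst nn_integral_real_affine[where c = 1 and t = "a \<bullet> G g"]) auto
    then show ?thesis
      by (simp add: inner_add_right a algebra_simps)
  qed
  then show ?thesis
    by (subst (1 2) fubini) simp_all
qed

lemma nn_integral_exp_square:
  assumes "d > 0"
  shows "(\<integral>\<^sup>+t. ennreal (exp (- (1/2) * (d * t\<^sup>2))) \<partial>lborel) = ennreal (sqrt (2 * pi / d))"
proof -
  have eq: "exp (- (1/2) * (d * t\<^sup>2)) = sqrt (2 * pi / d) * normal_density 0 (1 / sqrt d) t" for t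
    using assms by (simp add: normal_density_def power_divide real_sqrt_divide)
  have "(\<integral>\<^sup>+t. ennreal (normal_density 0 (1 / sqrt d) t) \<partial>lborel) = 1"
    using assms by (subst nn_integral_eq_integral) auto
  then show ?thesis
    unfolding eq using assms by (subst ennreal_mult) (auto simp: nn_integral_cmult)
qed

lemma prod_Basis_vec: "(\<Prod>b\<in>(Basis :: (real^'n) set). h b) = (\<Prod>i\<in>UNIV. h (axis i 1))"
  unfolding Basis_real_vec by (subst prod.reindex) (auto simp: inj_on_def axis_eq_axis)

lemma sum_Basis_vec: "(\<Sum>b\<in>(Basis :: (real^'n) set). h b) = (\<Sum>i\<in>UNIV. h (axis i 1))"
  unfolding Basis_real_vec by (subst sum.reindex) (auto simp: inj_on_def axis_eq_axis)

lemma sqrt_prod: "(\<Prod>i\<in>I. sqrt (f i)) = sqrt (\<Prod>i\<in>I. f i)"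
  by (induction I rule: infinite_finite_induct) (simp_all add: real_sqrt_mult)

lemma borel_measurable_matrix_vector [measurable]:
  fixes A :: "real^'n^'m"
  assumes [measurable]: "f \<in> borel_measurable M"
  shows "(\<lambda>x. A *v f x) \<in> borel_measurable M"
proof -
  have [measurable]: "(*v) A \<in> borel_measurable borel"
    by (intro borel_measurable_continuous_onI linear_continuous_on matrix_vector_mul_bounded_linear)
  show ?thesis by measurable
qed

lemma spd_diag_pos: "spd W \<Longrightarrow> W $ i $ i > 0"
  using inner_axis_matrix[of i W i] by (auto simp: spd_def dest: spec[of _ "axis i 1"])

text \<open>Without off-diagonal entries the exponential factorises over the coordinates, leaving a
  product of one-dimensional normal integrals.\<close>

lemma nn_integral_gauss_diagonal:
  fixes W :: "real^'n^'n"
  assumes "spd W" and diag: "\<And>i j. i \<noteq> j \<Longrightarrow> W $ i $ j = 0"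
  shows "(\<integral>\<^sup>+x. ennreal (exp (- (1/2) * (x \<bullet> (W *v x)))) \<partial>lborel)
    = ennreal (sqrt ((2 * pi) ^ CARD('n) / det W))"
proof -
  have pos: "W $ i $ i > 0" for i
    using spd_diag_pos[OF assms(1)] .
  have "(W *v x) $ i = W $ i $ i * x $ i" for x i
  proof -
    have "(W *v x) $ i = (\<Sum>j\<in>UNIV. if j = i then W $ i $ i * x $ i else 0)"
      unfolding matrix_vector_mult_def vec_lambda_beta by (intro sum.cong) (auto simp: diag)
    then show ?thesis by simp
  qed
  \<comment> \<open>The coefficients are written as \<open>b \<bullet> (W *v b)\<close> so that the
    sum runs over \<open>Basis\<close>, the index set of the product formula for
    \<open>lborel\<close>.\<close>
  then have quad: "x \<bullet> (W *v x) = (\<Sum>b\<in>Basis. (b \<bullet> (W *v b)) * (x \<bullet> b)\<^sup>2)" for x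
    by (simp add: sum_Basis_vec inner_axis_matrix inner_axis inner_vec_def[of x "W *v x"] power2_eq_square
        algebra_simps)
  have "exp (- (1/2) * (x \<bullet> (W *v x))) = (\<Prod>b\<in>Basis. exp (- (1/2) * ((b \<bullet> (W *v b)) * (x \<bullet> b)\<^sup>2)))" for x
    unfolding quad[of x] sum_distrib_left by (rule exp_sum) simp
  then have "(\<integral>\<^sup>+x. ennreal (exp (- (1/2) * (x \<bullet> (W *v x)))) \<partial>lborel)
     = (\<integral>\<^sup>+x. (\<Prod>b\<in>Basis. ennreal (exp (- (1/2) * ((b \<bullet> (W *v b)) * (x \<bullet> b)\<^sup>2)))) \<partial>lborel)"
    by (simp add: prod_ennreal)
  also have "\<dots> = (\<Prod>b\<in>(Basis :: (real^'n) set). ennreal (sqrt (2 * pi / (b \<bullet> (W *v b)))))"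
    by (subst nn_integral_lborel_prod[where f = "\<lambda>b t. ennreal (exp (- (1/2) * ((b \<bullet> (W *v b)) * t\<^sup>2)))"])
      (auto simp: Basis_real_vec inner_axis_matrix pos nn_integral_exp_square[OF pos, simplified]
        intro!: prod.cong)
  also have "\<dots> = ennreal (\<Prod>i\<in>UNIV. sqrt (2 * pi / W $ i $ i))"
    using pos by (simp add: prod_Basis_vec inner_axis_matrix prod_ennreal less_imp_le)
  also have "(\<Prod>i\<in>UNIV. sqrt (2 * pi / W $ i $ i)) = sqrt (\<Prod>i\<in>UNIV. 2 * pi / W $ i $ i)"
    by (simp add: sqrt_prod)
  also have "(\<Prod>i\<in>UNIV. 2 * pi / W $ i $ i) = (2 * pi) ^ CARD('n) / det W"
    by (simp add: det_diagonal diag prod_dividef)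
  finally show ?thesis .
qed

text \<open>Completing the square in one coordinate is a shear of determinant 1; repeating it diagonalises \<open>W\<close>.
  (The change of variables formula of the library needs well-ordered index types.)\<close>

lemma nn_integral_gauss:
  fixes W :: "real^'n^'n"
  assumes "spd W"
  shows "(\<integral>\<^sup>+x. ennreal (exp (- (1/2) * (x \<bullet> (W *v x)))) \<partial>lborel)
    = ennreal (sqrt ((2 * pi) ^ CARD('n) / det W))"
  using assms
\<comment> \<open>The measure counts the rows with a nonzero off-diagonal entry: one shear clears
  such a row and fills none that is already clear.\<close>
proof (induction "card {i. \<exists>j. j \<noteq> i \<and> W $ i $ j \<noteq> 0}" arbitrary: W rule: less_induct)
  case less
  have sym: "W $ i $ j = W $ j $ i" for i j
    using psd_nth_sym[OF spd_imp_psd[OF less.prems]] .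
  show ?case
  proof (cases "\<exists>i j. j \<noteq> i \<and> W $ i $ j \<noteq> 0")
    case False
    then show ?thesis using nn_integral_gauss_diagonal[OF less.prems] by metis
  next
    case True
    then obtain i j0 where i: "j0 \<noteq> i" "W $ i $ j0 \<noteq> 0" by blast
    have pos: "W $ i $ i > 0"
      using spd_diag_pos[OF less.prems] .
    \<comment> \<open>These values cancel the off-diagonal entries of row i in \<open>W'\<close>;
      the zero at i keeps the shear volume-preserving.\<close>
    define a :: "real^'n" where "a = (\<chi> j. if j = i then 0 else - W $ i $ j / W $ i $ i)"
    define T :: "real^'n^'n" where "T = (\<chi> k. if k = i then row i (mat 1) + a else row k (mat 1))"
    have T: "T *v x = x + (a \<bullet> x) *\<^sub>R axis i 1" for x
    proof -
      have "(T *v x) $ k = (x + (a \<bullet> x) *\<^sub>R axis i 1) $ k" for k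
      proof -
        have "(T *v x) $ k = T $ k \<bullet> x" by (simp add: matrix_vector_mul_component)
        also have "\<dots> = x $ k + (if k = i then a \<bullet> x else 0)"
        proof -
          have "row k (mat 1 :: real^'n^'n) = axis k 1"
            by (simp add: row_def mat_def axis_def vec_eq_iff)
          then show ?thesis
            by (auto simp: T_def inner_add_left inner_axis')
        qed
        finally show ?thesis by (simp add: axis_def)
      qed
      then show ?thesis by (simp add: vec_eq_iff)
    qed
    \<comment> \<open>\<open>T\<close> is the identity with a combination of the other rows added to
      row i.\<close>
    have "det T = det (mat 1 :: real^'n^'n)"
      unfolding T_def
    proof (rule det_row_span)
      have "a = (\<Sum>j\<in>-{i}. a $ j *s row j (mat 1))"
        by (simp add: vec_eq_iff row_def mat_def a_def if_distrib if_distribR sum.If_cases cong: if_cong)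
      moreover have "(\<Sum>j\<in>-{i}. a $ j *s row j (mat 1)) \<in> vec.span {row j (mat 1) |j. j \<noteq> i}"
        by (intro vec.span_sum vec.span_scale vec.span_base) auto
      ultimately show "a \<in> vec.span {row j (mat 1) |j. j \<noteq> i}" by metis
    qed
    then have detT: "det T = 1" by simp
    define W' where "W' = transpose T ** W ** T"
    have quad: "x \<bullet> (W' *v z) = (T *v x) \<bullet> (W *v (T *v z))" for x z
      by (simp add: W'_def dot_transpose matrix_vector_mul_assoc[symmetric])
    have "spd W'"
      unfolding spd_def
    proof (intro conjI allI impI)
      show "transpose W' = W'"
        using less.prems by (simp add: W'_def matrix_transpose_mul matrix_mul_assoc spd_def)
      fix v :: "real^'n" assume "v \<noteq> 0"
      have "invertible T" using detT by (simp add: invertible_det_nz)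
      then have "T *v v \<noteq> 0"
        using \<open>v \<noteq> 0\<close> matrix_inv_mult(2)[of T] matrix_vector_mul_assoc[of "matrix_inv T" T v] by auto
      then show "0 < v \<bullet> (W' *v v)"
        using less.prems unfolding quad spd_def by blast
    qed
    have W': "W' $ j $ l = W $ j $ l + a $ j * W $ i $ l + a $ l * W $ j $ i + a $ j * a $ l * W $ i $ i" for j l
    proof -
      have "W' $ j $ l = (T *v axis j 1) \<bullet> (W *v (T *v axis l 1))"
        using quad[of "axis j 1" "axis l 1"] by (simp only: inner_axis_matrix)
      also have "\<dots> = W $ j $ l + a $ j * W $ i $ l + a $ l * W $ j $ i + a $ j * a $ l * W $ i $ i"
        by (simp only: T matrix_vector_right_distrib matrix_vector_mult_scaleR inner_add_left
            inner_add_right inner_scaleR_left inner_scaleR_right inner_axis_matrix)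
          (simp add: inner_axis algebra_simps)
      finally show ?thesis .
    qed
    have row_i: "W' $ i $ l = 0" if "l \<noteq> i" for l
      using that pos by (simp add: W' a_def)
    \<comment> \<open>A row k that is already clear has \<open>W $ k $ i = 0\<close>, hence
      \<open>a $ k = 0\<close>, so every correction term in row k vanishes.\<close>
    have keep: "\<exists>l. l \<noteq> k \<and> W $ k $ l \<noteq> 0" if "k \<noteq> i" "l \<noteq> k" "W' $ k $ l \<noteq> 0" for k l
    proof (rule ccontr)
      assume *: "\<not> (\<exists>l. l \<noteq> k \<and> W $ k $ l \<noteq> 0)"
      then have W0: "W $ k $ i = 0" "W $ k $ l = 0" using that(1,2) by auto
      then have "a $ k = 0" using sym[of i k] by (simp add: a_def)
      then show False using that(3) W0 unfolding W'[of k l] by simp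
    qed
    have "{k. \<exists>l. l \<noteq> k \<and> W' $ k $ l \<noteq> 0} \<subset> {k. \<exists>l. l \<noteq> k \<and> W $ k $ l \<noteq> 0}"
    proof (rule psubsetI)
      show "{k. \<exists>l. l \<noteq> k \<and> W' $ k $ l \<noteq> 0} \<subseteq> {k. \<exists>l. l \<noteq> k \<and> W $ k $ l \<noteq> 0}"
      proof
        fix k
        assume "k \<in> {k. \<exists>l. l \<noteq> k \<and> W' $ k $ l \<noteq> 0}"
        then obtain l where l: "l \<noteq> k" "W' $ k $ l \<noteq> 0" by auto
        with row_i have "k \<noteq> i" by auto
        from keep[OF this l] show "k \<in> {k. \<exists>l. l \<noteq> k \<and> W $ k $ l \<noteq> 0}" by simp
      qed
      have "i \<notin> {k. \<exists>l. l \<noteq> k \<and> W' $ k $ l \<noteq> 0}"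
        using row_i by auto
      moreover have "i \<in> {k. \<exists>l. l \<noteq> k \<and> W $ k $ l \<noteq> 0}"
        using i by auto
      ultimately show "{k. \<exists>l. l \<noteq> k \<and> W' $ k $ l \<noteq> 0} \<noteq> {k. \<exists>l. l \<noteq> k \<and> W $ k $ l \<noteq> 0}"
        by metis
    qed
    then have "card {k. \<exists>l. l \<noteq> k \<and> W' $ k $ l \<noteq> 0} < card {k. \<exists>l. l \<noteq> k \<and> W $ k $ l \<noteq> 0}"
      by (intro psubset_card_mono) auto
    from less.hyps[OF this \<open>spd W'\<close>]
    have "(\<integral>\<^sup>+x. ennreal (exp (- (1/2) * (x \<bullet> (W' *v x)))) \<partial>lborel)
      = ennreal (sqrt ((2 * pi) ^ CARD('n) / det W'))" .
    moreover have "det W' = det W"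
      by (simp add: W'_def det_mul detT)
    moreover have "(\<integral>\<^sup>+x. ennreal (exp (- (1/2) * (x \<bullet> (W' *v x)))) \<partial>lborel)
      = (\<integral>\<^sup>+x. ennreal (exp (- (1/2) * (x \<bullet> (W *v x)))) \<partial>lborel)"
      unfolding quad unfolding T
      by (rule nn_integral_shear[where f = "\<lambda>x. ennreal (exp (- (1/2) * (x \<bullet> (W *v x))))"])
        (auto simp: axis_in_Basis_iff a_def inner_axis)
    ultimately show ?thesis by simp
  qed
qed

lemma integrable_gauss:
  fixes W :: "real^'n^'n"
  assumes "spd W"
  shows "integrable lborel (\<lambda>x. exp (- (1/2) * (x \<bullet> (W *v x))))"
    and integral_gauss: "(\<integral>x. exp (- (1/2) * (x \<bullet> (W *v x))) \<partial>lborel) = sqrt ((2 * pi) ^ CARD('n) / det W)"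
proof -
  have "has_bochner_integral lborel (\<lambda>x. exp (- (1/2) * (x \<bullet> (W *v x))))
      (sqrt ((2 * pi) ^ CARD('n) / det W))"
    using nn_integral_gauss[OF assms] spd_det_pos[OF assms]
    by (intro has_bochner_integral_nn_integral) auto
  then show "integrable lborel (\<lambda>x. exp (- (1/2) * (x \<bullet> (W *v x))))"
    "(\<integral>x. exp (- (1/2) * (x \<bullet> (W *v x))) \<partial>lborel) = sqrt ((2 * pi) ^ CARD('n) / det W)"
    by (simp_all only: has_bochner_integral_iff)
qed

section \<open>Translation, reflection and domination for Lebesgue integrals\<close>

lemma integral_lborel_translate:
  fixes f :: "'a::euclidean_space \<Rightarrow> 'b::{banach, second_countable_topology}"
  assumes [measurable]: "f \<in> borel_measurable borel"
  shows "integral\<^sup>L lborel (\<lambda>x. f (x - c)) = integral\<^sup>L lborel f"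
    and "integrable lborel (\<lambda>x. f (x - c)) \<longleftrightarrow> integrable lborel f"
proof -
  have *: "distr lborel borel ((+) (- c)) = lborel" by (rule lborel_distr_plus)
  show "integral\<^sup>L lborel (\<lambda>x. f (x - c)) = integral\<^sup>L lborel f"
    by (subst (2) *[symmetric]) (simp add: integral_distr)
  show "integrable lborel (\<lambda>x. f (x - c)) \<longleftrightarrow> integrable lborel f"
    by (subst (2) *[symmetric]) (simp add: integrable_distr_eq)
qed

text \<open>Reflection preserves Lebesgue measure, so the integral equals its own negative. This
  covers nonintegrable f too, whose Bochner integral is 0 by convention.\<close>

lemma integral_lborel_odd:
  fixes f :: "'a::euclidean_space \<Rightarrow> 'b::{banach, second_countable_topology}"
  assumes [measurable]: "f \<in> borel_measurable borel" and "\<And>x. f (- x) = - f x"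
  shows "integral\<^sup>L lborel f = 0"
proof -
  have "distr lborel borel (uminus :: 'a \<Rightarrow> 'a) = lborel"
    using lborel_affine[of "-1" "0 :: 'a"] by (simp add: density_1)
  moreover have "integral\<^sup>L (distr lborel borel uminus) f = (\<integral>x. f (- x) \<partial>lborel)"
    by (rule integral_distr) simp_all
  ultimately have "integral\<^sup>L lborel f = (\<integral>x. f (- x) \<partial>lborel)"
    by simp
  also have "\<dots> = - integral\<^sup>L lborel f"
    unfolding assms(2) by (rule Bochner_Integration.integral_minus)
  finally have "2 *\<^sub>R integral\<^sup>L lborel f = 0"
    unfolding scaleR_2 eq_neg_iff_add_eq_0 .
  then show ?thesis by simp
qed

text \<open>Half of the exponent is spent on absorbing the quadratic factor; the other half is again
  Gaussian, with matrix W/2, and serves as the majorant.\<close>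

lemma integrable_gauss_quadratic:
  fixes W :: "real^'n^'n" and f :: "real^'n \<Rightarrow> 'b::{banach, second_countable_topology}"
  assumes "spd W" and [measurable]: "f \<in> borel_measurable borel"
    and bound: "\<And>x. norm (f x) \<le> a * (1 + (norm x)\<^sup>2) * exp (- (1/2) * (x \<bullet> (W *v x)))"
  shows "integrable lborel f"
proof -
  obtain c where c: "c > 0" "\<And>x. c * (norm x)\<^sup>2 \<le> x \<bullet> (W *v x)"
    using spd_lower_bound[OF assms(1)] by blast
  have "0 \<le> a"
    using order_trans[OF norm_ge_zero bound[of 0]] by simp
  \<comment> \<open>The constant 4/c comes from exp s \<ge> s at s = ct/4. As c |x|^2 lies below the
    form of W, this uses at most a quarter of the form.\<close>
  have "1 + t \<le> (1 + 4 / c) * exp (c / 4 * t)" if "t \<ge> 0" for t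
  proof -
    have "1 \<le> exp (c / 4 * t)" using c that by simp
    moreover have "t \<le> 4 / c * exp (c / 4 * t)"
      using exp_ge_add_one_self[of "c / 4 * t"] c that by (simp add: field_simps)
    ultimately show ?thesis unfolding distrib_right mult_1_left by (rule add_mono)
  qed
  then have "norm (f x) \<le> a * (1 + 4 / c) * exp (- (1/2) * (x \<bullet> (((1/2) *\<^sub>R W) *v x)))" for x
  proof -
    have "norm (f x) \<le> a * (1 + (norm x)\<^sup>2) * exp (- (1/2) * (x \<bullet> (W *v x)))"
      by (rule bound)
    also have "\<dots> \<le> a * ((1 + 4 / c) * exp (c / 4 * (norm x)\<^sup>2)) * exp (- (1/2) * (x \<bullet> (W *v x)))"
      by (intro mult_right_mono mult_left_mono \<open>0 \<le> a\<close> \<open>\<And>t. t \<ge> 0 \<Longrightarrow> 1 + t \<le> (1 + 4 / c) * exp (c / 4 * t)\<close>) auto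
    also have "\<dots> \<le> a * ((1 + 4 / c) * exp (1 / 4 * (x \<bullet> (W *v x)))) * exp (- (1/2) * (x \<bullet> (W *v x)))"
      using c by (intro mult_right_mono mult_left_mono \<open>0 \<le> a\<close>) (auto simp: field_simps)
    also have "\<dots> = a * (1 + 4 / c) * exp (- (1/2) * (x \<bullet> (((1/2) *\<^sub>R W) *v x)))"
      by (simp add: scaleR_matrix_vector_assoc[symmetric] mult.assoc exp_add[symmetric])
    finally show ?thesis .
  qed
  moreover have "integrable lborel (\<lambda>x. a * (1 + 4 / c) * exp (- (1/2) * (x \<bullet> (((1/2) *\<^sub>R W) *v x))))"
    by (intro integrable_mult_right integrable_gauss spd_scaleR assms(1)) simp
  ultimately show ?thesis
    by (elim Bochner_Integration.integrable_bound)
      (auto intro!: AE_I2 order_trans[OF _ abs_ge_self] simp del: abs_mult)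
qed

section \<open>Gaussian densities and their normalisation\<close>

lemma gauss_density_pos: "spd P \<Longrightarrow> gauss_density m P x > 0"
  by (simp add: gauss_density_def spd_det_pos)

lemma borel_measurable_gauss_density [measurable]:
  assumes [measurable]: "f \<in> borel_measurable M"
  shows "(\<lambda>x. gauss_density m P (f x)) \<in> borel_measurable M"
  unfolding gauss_density_def by measurable

lemma det_matrix_inv: "spd P \<Longrightarrow> det (matrix_inv P) = 1 / det P"
  using spd_inv_mult(1)[of P] spd_det_pos[of P]
  by (metis det_I det_mul less_irrefl nonzero_eq_divide_eq mult.commute)

lemma gauss_density_translate: "gauss_density m P x = gauss_density 0 P (x - m)"
  by (simp add: gauss_density_def)

lemma gauss_density_integral:
  fixes P :: "real^'n^'n"
  assumes "spd P"
  shows "integrable lborel (gauss_density m P)" "integral\<^sup>L lborel (gauss_density m P) = 1"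
proof -
  have *: "gauss_density 0 P = (\<lambda>x. exp (- (1/2) * (x \<bullet> (matrix_inv P *v x))) / sqrt ((2 * pi) ^ CARD('n) * det P))"
    by (simp add: gauss_density_def fun_eq_iff)
  have "integrable lborel (gauss_density 0 P)" "integral\<^sup>L lborel (gauss_density 0 P) = 1"
    unfolding * using integrable_gauss[OF spd_matrix_inv[OF assms]] integral_gauss[OF spd_matrix_inv[OF assms]]
      spd_det_pos[OF assms]
    by (simp_all add: det_matrix_inv assms)
  moreover have "gauss_density m P = (\<lambda>x. gauss_density 0 P (x - m))"
    using gauss_density_translate by blast
  ultimately show "integrable lborel (gauss_density m P)" "integral\<^sup>L lborel (gauss_density m P) = 1"
    using integral_lborel_translate[of "gauss_density 0 P" m] by simp_all
qed

section \<open>Differentiating a Laplace transform at the origin\<close>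

lemma exp_norm_le_sum_exp:
  fixes u :: "'a::euclidean_space"
  defines "r \<equiv> 2 * real DIM('a)"
  shows "exp (2 * norm u) \<le> (\<Sum>b\<in>Basis. exp ((r *\<^sub>R b) \<bullet> u) + exp ((- r *\<^sub>R b) \<bullet> u))"
proof -
  \<comment> \<open>Some coordinate carries at least the fraction 1/DIM of the norm. With r = 2 DIM,
    one of the finitely many exponentials in the sum is then at least exp(2 |u|).\<close>
  obtain b :: 'a where b: "b \<in> Basis" "norm u \<le> real DIM('a) * \<bar>u \<bullet> b\<bar>"
  proof (rule ccontr)
    assume "\<not> thesis"
    then have *: "real DIM('a) * \<bar>u \<bullet> b\<bar> < norm u" if "b \<in> Basis" for b :: 'a
      using that \<open>\<And>b. b \<in> Basis \<Longrightarrow> norm u \<le> real DIM('a) * \<bar>u \<bullet> b\<bar> \<Longrightarrow> thesis\<close> by force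
    have "(\<Sum>b\<in>Basis. \<bar>u \<bullet> b\<bar>) < (\<Sum>b\<in>(Basis::'a set). norm u / real DIM('a))"
      using * by (intro sum_strict_mono) (auto simp: field_simps)
    then show False using norm_le_l1[of u] by simp
  qed
  have "exp (2 * norm u) \<le> exp (r * \<bar>u \<bullet> b\<bar>)"
    using b by (simp add: r_def)
  also have "\<dots> \<le> exp ((r *\<^sub>R b) \<bullet> u) + exp ((- r *\<^sub>R b) \<bullet> u)"
    by (cases "u \<bullet> b \<ge> 0") (auto simp: inner_commute)
  also have "\<dots> \<le> (\<Sum>b\<in>Basis. exp ((r *\<^sub>R b) \<bullet> u) + exp ((- r *\<^sub>R b) \<bullet> u))"
    using member_le_sum[of b Basis "\<lambda>b. exp ((r *\<^sub>R b) \<bullet> u) + exp ((- r *\<^sub>R b) \<bullet> u)"] b(1)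
    by (simp add: add_nonneg_nonneg)
  finally show ?thesis .
qed

lemma exp_taylor_remainder: "\<bar>exp t - 1 - t\<bar> \<le> t\<^sup>2 / 2 * exp \<bar>t\<bar>" for t :: real
proof -
  obtain s where s: "\<bar>s\<bar> \<le> \<bar>t\<bar>" "exp t = (\<Sum>m<2. t ^ m / fact m) + exp s / fact 2 * t ^ 2"
    using Maclaurin_exp_le[of t 2] by blast
  then have "exp t - 1 - t = t\<^sup>2 / 2 * exp s"
    by (simp add: numeral_2_eq_2)
  then have "\<bar>exp t - 1 - t\<bar> = t\<^sup>2 / 2 * exp s"
    by (simp only: abs_mult) simp
  also have "\<dots> \<le> t\<^sup>2 / 2 * exp \<bar>t\<bar>"
    using s(1) by (intro mult_left_mono) auto
  finally show ?thesis .
qed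

text \<open>Integrability at finitely many h, the positive and negative multiples r b of the basis
  vectors, yields one integrable majorant of exp(2 |u|) |G|. The Taylor remainder of the exponential
  is at most |h|^2 times it, so the remainder of the integral is of second order.\<close>

lemma laplace_transform_derivative:
  fixes G :: "'a \<Rightarrow> 'b::{banach, second_countable_topology}" and u :: "'a \<Rightarrow> 'c::euclidean_space"
  assumes int: "\<And>h. integrable M (\<lambda>\<xi>. exp (h \<bullet> u \<xi>) *\<^sub>R G \<xi>)"
    and [measurable]: "u \<in> borel_measurable M"
  shows "integrable M (\<lambda>\<xi>. (h \<bullet> u \<xi>) *\<^sub>R G \<xi>)"
    and "((\<lambda>h. \<integral>\<xi>. exp (h \<bullet> u \<xi>) *\<^sub>R G \<xi> \<partial>M) has_derivative
          (\<lambda>h. \<integral>\<xi>. (h \<bullet> u \<xi>) *\<^sub>R G \<xi> \<partial>M)) (at 0)"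
proof -
  define r where "r = 2 * real DIM('c)"
  define E where "E \<xi> = (\<Sum>b\<in>Basis. exp ((r *\<^sub>R b) \<bullet> u \<xi>) + exp ((- r *\<^sub>R b) \<bullet> u \<xi>))" for \<xi>
  have E: "exp (2 * norm (u \<xi>)) \<le> E \<xi>" for \<xi>
    unfolding E_def r_def by (rule exp_norm_le_sum_exp)
  have intG: "integrable M G" using int[of 0] by simp
  then have [measurable]: "G \<in> borel_measurable M" by simp
  have intE: "integrable M (\<lambda>\<xi>. E \<xi> * norm (G \<xi>))"
  proof -
    have "integrable M (\<lambda>\<xi>. exp (h \<bullet> u \<xi>) * norm (G \<xi>))" for h
      using integrable_norm[OF int[of h]] by simp
    then show ?thesis
      unfolding E_def sum_distrib_right distrib_right
      by (intro Bochner_Integration.integrable_sum Bochner_Integration.integrable_add)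
  qed
  have u_le: "norm (u \<xi>) \<le> E \<xi>" for \<xi>
  proof -
    have "norm (u \<xi>) \<le> exp (2 * norm (u \<xi>))"
      using exp_ge_add_one_self[of "2 * norm (u \<xi>)"] norm_ge_zero[of "u \<xi>"] by linarith
    then show ?thesis using E[of \<xi>] by linarith
  qed
  have E_nonneg: "0 \<le> E \<xi>" for \<xi>
    using u_le[of \<xi>] norm_ge_zero[of "u \<xi>"] by linarith
  show intD: "integrable M (\<lambda>\<xi>. (h \<bullet> u \<xi>) *\<^sub>R G \<xi>)" for h
  proof (rule Bochner_Integration.integrable_bound)
    show "integrable M (\<lambda>\<xi>. norm h * (E \<xi> * norm (G \<xi>)))"
      using intE by simp
    show "AE \<xi> in M. norm ((h \<bullet> u \<xi>) *\<^sub>R G \<xi>) \<le> norm (norm h * (E \<xi> * norm (G \<xi>)))"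
    proof (rule AE_I2)
      fix \<xi>
      have "\<bar>h \<bullet> u \<xi>\<bar> \<le> norm h * E \<xi>"
        using Cauchy_Schwarz_ineq2[of h "u \<xi>"] mult_left_mono[OF u_le[of \<xi>], of "norm h"] by simp
      then show "norm ((h \<bullet> u \<xi>) *\<^sub>R G \<xi>) \<le> norm (norm h * (E \<xi> * norm (G \<xi>)))"
        using mult_right_mono[of "\<bar>h \<bullet> u \<xi>\<bar>" "norm h * E \<xi>" "norm (G \<xi>)"] E_nonneg[of \<xi>]
        by (simp add: abs_mult mult.assoc)
    qed
  qed simp
  define C where "C = (\<integral>\<xi>. E \<xi> * norm (G \<xi>) \<partial>M)"
  have rem: "norm (((\<integral>\<xi>. exp (h \<bullet> u \<xi>) *\<^sub>R G \<xi> \<partial>M) - (\<integral>\<xi>. G \<xi> \<partial>M)) - (\<integral>\<xi>. (h \<bullet> u \<xi>) *\<^sub>R G \<xi> \<partial>M))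
      \<le> (norm h)\<^sup>2 * C" if "norm h < 1" for h
  proof -
    have "((\<integral>\<xi>. exp (h \<bullet> u \<xi>) *\<^sub>R G \<xi> \<partial>M) - (\<integral>\<xi>. G \<xi> \<partial>M)) - (\<integral>\<xi>. (h \<bullet> u \<xi>) *\<^sub>R G \<xi> \<partial>M)
      = (\<integral>\<xi>. (exp (h \<bullet> u \<xi>) - 1 - h \<bullet> u \<xi>) *\<^sub>R G \<xi> \<partial>M)"
      using int[of h] intG intD[of h] by (simp add: scaleR_left_diff_distrib)
    moreover have "norm (\<integral>\<xi>. (exp (h \<bullet> u \<xi>) - 1 - h \<bullet> u \<xi>) *\<^sub>R G \<xi> \<partial>M)
        \<le> (\<integral>\<xi>. (norm h)\<^sup>2 * (E \<xi> * norm (G \<xi>)) \<partial>M)"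
    proof (rule order_trans[OF Bochner_Integration.integral_norm_bound Bochner_Integration.integral_mono])
      have "integrable M (\<lambda>\<xi>. (exp (h \<bullet> u \<xi>) - 1 - h \<bullet> u \<xi>) *\<^sub>R G \<xi>)"
        using int[of h] intG intD[of h] by (simp add: scaleR_left_diff_distrib)
      then show "integrable M (\<lambda>\<xi>. norm ((exp (h \<bullet> u \<xi>) - 1 - h \<bullet> u \<xi>) *\<^sub>R G \<xi>))"
        by (rule integrable_norm)
      show "integrable M (\<lambda>\<xi>. (norm h)\<^sup>2 * (E \<xi> * norm (G \<xi>)))"
        using intE by simp
      fix \<xi>
      define t n where "t = h \<bullet> u \<xi>" and "n = norm (u \<xi>)"
      have t: "\<bar>t\<bar> \<le> norm h * n" unfolding t_def n_def by (rule Cauchy_Schwarz_ineq2)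
      then have t2: "t\<^sup>2 \<le> (norm h)\<^sup>2 * n\<^sup>2"
        by (metis abs_ge_zero power2_abs power_mono power_mult_distrib)
      have tn: "\<bar>t\<bar> \<le> n"
        using t that mult_right_mono[of "norm h" 1 n] by (simp add: n_def)
      \<comment> \<open>This is where the 2 in exp(2 |u|) is spent: one factor exp n bounds n^2/2,
        the other bounds exp |t|, as |h| < 1.\<close>
      have "n\<^sup>2 / 2 \<le> exp n"
      proof -
        have "0 \<le> n" by (simp add: n_def)
        then show ?thesis using exp_lower_Taylor_quadratic[of n] by linarith
      qed
      have "\<bar>exp t - 1 - t\<bar> \<le> t\<^sup>2 / 2 * exp \<bar>t\<bar>" by (rule exp_taylor_remainder)
      also have "\<dots> \<le> ((norm h)\<^sup>2 * n\<^sup>2) / 2 * exp n"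
        using t2 tn by (intro mult_mono) auto
      also have "\<dots> = (norm h)\<^sup>2 * (n\<^sup>2 / 2 * exp n)" by simp
      also have "\<dots> \<le> (norm h)\<^sup>2 * (exp n * exp n)"
        using \<open>n\<^sup>2 / 2 \<le> exp n\<close> by (intro mult_left_mono mult_right_mono) auto
      also have "\<dots> \<le> (norm h)\<^sup>2 * E \<xi>"
        using E[of \<xi>] by (intro mult_left_mono) (auto simp: n_def exp_add[symmetric])
      finally show "norm ((exp (h \<bullet> u \<xi>) - 1 - h \<bullet> u \<xi>) *\<^sub>R G \<xi>) \<le> (norm h)\<^sup>2 * (E \<xi> * norm (G \<xi>))"
        using mult_right_mono[of _ "(norm h)\<^sup>2 * E \<xi>" "norm (G \<xi>)"] by (simp add: t_def mult.assoc)
    qed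
    ultimately show ?thesis by (simp add: C_def)
  qed
  show "((\<lambda>h. \<integral>\<xi>. exp (h \<bullet> u \<xi>) *\<^sub>R G \<xi> \<partial>M) has_derivative
          (\<lambda>h. \<integral>\<xi>. (h \<bullet> u \<xi>) *\<^sub>R G \<xi> \<partial>M)) (at 0)"
  proof (rule has_derivativeI_sandwich[of 1])
    have "linear (\<lambda>h. \<integral>\<xi>. (h \<bullet> u \<xi>) *\<^sub>R G \<xi> \<partial>M)"
      using intD by (intro linearI) (simp_all add: inner_add_left scaleR_left_distrib
          scaleR_scaleR[symmetric] del: scaleR_scaleR)
    then show "bounded_linear (\<lambda>h. \<integral>\<xi>. (h \<bullet> u \<xi>) *\<^sub>R G \<xi> \<partial>M)"
      by (simp add: linear_conv_bounded_linear)
    show "((\<lambda>h. norm h * C) \<longlongrightarrow> 0) (at 0)"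
      by (auto intro!: tendsto_eq_intros)
    fix h :: 'c
    assume "h \<noteq> 0" "dist h 0 < 1"
    then show "norm ((\<integral>\<xi>. exp (h \<bullet> u \<xi>) *\<^sub>R G \<xi> \<partial>M) - (\<integral>\<xi>. exp (0 \<bullet> u \<xi>) *\<^sub>R G \<xi> \<partial>M)
        - (\<integral>\<xi>. ((h - 0) \<bullet> u \<xi>) *\<^sub>R G \<xi> \<partial>M)) / norm (h - 0) \<le> norm h * C"
      using rem[of h] by (simp add: divide_le_eq power2_eq_square mult_ac)
  qed simp
qed

section \<open>Sum of a possibly degenerate and a nondegenerate Gaussian noise\<close>

lemma integral_lborel_pos:
  fixes f :: "'a::euclidean_space \<Rightarrow> real"
  assumes "integrable lborel f" "\<And>x. f x > 0"
  shows "integral\<^sup>L lborel f > 0"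
proof -
  have "integral\<^sup>L lborel f \<noteq> 0"
  proof
    assume "integral\<^sup>L lborel f = 0"
    then have "AE x in lborel. f x = 0"
      using integral_nonneg_eq_0_iff_AE[OF assms(1)] assms(2) by (simp add: less_imp_le)
    then have "AE x in (lborel :: 'a measure). False"
      by (rule AE_mp) (use assms(2) in \<open>auto intro!: AE_I2 simp: less_le\<close>)
    then have "ae_filter (lborel :: 'a measure) = bot"
      by (simp add: trivial_limit_def)
    then show False by (simp add: ae_filter_eq_bot_iff)
  qed
  moreover have "integral\<^sup>L lborel f \<ge> 0"
    using assms(2) by (intro Bochner_Integration.integral_nonneg) (simp add: less_imp_le)
  ultimately show ?thesis by simp
qed

lemma matrix_inv_mat_1: "matrix_inv (mat 1 :: real^'n^'n) = mat 1"
  by (rule matrix_inv_unique) simp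

text \<open>This bound lets the standard normal dominate the integrand of the mixture.\<close>

lemma gauss_density_le_0:
  assumes "spd P"
  shows "gauss_density 0 P x \<le> gauss_density 0 P 0"
  using spd_imp_psd[OF spd_matrix_inv[OF assms]] spd_det_pos[OF assms]
  by (simp add: gauss_density_def psd_def divide_right_mono)

text \<open>Completing the square around \<open>z = A\<^sup>T (B + C)\<^sup>-\<^sup>1 v\<close>.\<close>

lemma noise_density_gauss:
  fixes B C :: "real^'n^'n"
  assumes B: "spd B" and C: "psd C"
  shows "\<exists>c>0. \<forall>v. noise_density C B v = c * exp (- (1/2) * (v \<bullet> (matrix_inv (B + C) *v v)))"
proof -
  define A :: "real^'n^'n" where "A = (SOME A. A ** transpose A = C)"
  have A: "A ** transpose A = C"
    unfolding A_def using psd_root[OF C] by (rule someI_ex)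
  define phi :: "real^'n \<Rightarrow> real" where "phi = gauss_density 0 (mat 1)"
  define gB where "gB = gauss_density 0 B"
  have [measurable]: "phi \<in> borel_measurable borel" "gB \<in> borel_measurable borel"
    unfolding phi_def gB_def by measurable
  have phi_pos: "phi z > 0" and gB_pos: "gB z > 0" for z
    unfolding phi_def gB_def using gauss_density_pos[OF spd_mat_1] gauss_density_pos[OF B] by auto
  have law: "gauss_law 0 C = distr (density lborel (\<lambda>z. ennreal (phi z))) borel (\<lambda>z. A *v z)"
    unfolding gauss_law_def A_def[symmetric] phi_def Let_def by simp
  have noise: "noise_density C B v = (\<integral>z. phi z * gB (v - A *v z) \<partial>lborel)" for v
  proof -
    have "noise_density C B v = (\<integral>z. gB (v - A *v z) \<partial>density lborel (\<lambda>z. ennreal (phi z)))"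
      unfolding noise_density_def law gB_def[symmetric] by (rule integral_distr) measurable
    also have "\<dots> = (\<integral>z. phi z * gB (v - A *v z) \<partial>lborel)"
      using phi_pos by (intro integral_real_density) (auto simp: less_imp_le)
    finally show ?thesis .
  qed
  \<comment> \<open>The factor left once the dependence on v is split off, that is, the value of the
    density at v = 0.\<close>
  define c where "c = (\<integral>t. phi t * gB (A *v t) \<partial>lborel)"
  have "integrable lborel (\<lambda>t. phi t * gB (A *v t))"
  proof (rule Bochner_Integration.integrable_bound)
    show "integrable lborel (\<lambda>t. phi t * gB 0)"
      unfolding phi_def by (intro integrable_mult_left gauss_density_integral(1) spd_mat_1)
    show "AE t in lborel. norm (phi t * gB (A *v t)) \<le> norm (phi t * gB 0)"
      using gauss_density_le_0[OF B] phi_pos gB_pos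
      by (intro AE_I2) (simp add: abs_mult abs_of_pos gB_def)
  qed measurable
  then have "c > 0"
    unfolding c_def using phi_pos gB_pos by (intro integral_lborel_pos) auto
  moreover have "noise_density C B v = c * exp (- (1/2) * (v \<bullet> (matrix_inv (B + C) *v v)))" for v
  proof -
    have BC: "spd (B + C)" using spd_add_psd[OF B C] .
    define u where "u = matrix_inv (B + C) *v v"
    \<comment> \<open>Since also A z = C u, what is left of v after removing A z is B u. These
      relations make the terms linear in t cancel in the square below.\<close>
    have v: "v = B *v u + C *v u"
      using spd_inv_vec(1)[OF BC, of v] by (simp add: u_def matrix_vector_mult_add_rdistrib)
    define z where "z = transpose A *v u"
    have Az: "A *v z = C *v u"
      by (simp add: z_def matrix_vector_mul_assoc A)
    have zz: "z \<bullet> z = u \<bullet> (C *v u)"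
      unfolding Az[symmetric] by (simp add: z_def dot_transpose)
    have tz: "t \<bullet> z = (A *v t) \<bullet> u" for t
      by (simp add: z_def dot_transpose)
    define w where "w t = A *v t" for t
    have quad: "(t + z) \<bullet> (t + z) + (B *v u - w t) \<bullet> (matrix_inv B *v (B *v u - w t))
      = v \<bullet> u + (t \<bullet> t + w t \<bullet> (matrix_inv B *v w t))" for t
    proof -
      have "(B *v u) \<bullet> (matrix_inv B *v w t) = u \<bullet> w t"
        using B by (simp add: dot_transpose spd_def spd_inv_vec(1)[OF B])
      then show ?thesis
        using tz[of t] zz by (simp add: matrix_vector_mult_diff_distrib inner_simps spd_inv_vec(2)[OF B]
            v w_def inner_commute algebra_simps)
    qed
    have "phi (t + z) * gB (v - A *v (t + z)) = exp (- (1/2) * (v \<bullet> u)) * (phi t * gB (A *v t))" for t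
    proof -
      have *: "v - A *v (t + z) = B *v u - w t"
        unfolding v by (simp add: matrix_vector_right_distrib Az w_def)
      have "exp (- (1/2) * ((t + z) \<bullet> (t + z))) * exp (- (1/2) * ((B *v u - w t) \<bullet> (matrix_inv B *v (B *v u - w t))))
        = exp (- (1/2) * (v \<bullet> u)) * (exp (- (1/2) * (t \<bullet> t)) * exp (- (1/2) * (w t \<bullet> (matrix_inv B *v w t))))"
        unfolding exp_add[symmetric] distrib_left[symmetric] quad ..
      then show ?thesis
        unfolding * phi_def gB_def gauss_density_def matrix_inv_mat_1 w_def by simp
    qed
    then have "(\<integral>t. phi (t - (- z)) * gB (v - A *v (t - (- z))) \<partial>lborel) = exp (- (1/2) * (v \<bullet> u)) * c"
      unfolding c_def by simp
    moreover have "(\<integral>t. phi (t - (- z)) * gB (v - A *v (t - (- z))) \<partial>lborel) = noise_density C B v"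
      unfolding noise by (rule integral_lborel_translate) measurable
    ultimately show ?thesis by (simp add: u_def mult.commute)
  qed
  ultimately show ?thesis by blast
qed

section \<open>Statistical linear regression\<close>

text \<open>Exponential tilting: completing the square turns a weight with exponent linear in the
  variable into a shift of the mean by h, up to a factor free of the variable. A Gaussian mean, as a
  function of its centre, is thus a Laplace transform in h.\<close>

lemma gauss_density_tilt:
  assumes "spd P"
  shows "exp (h \<bullet> (matrix_inv P *v (\<xi> - x))) * gauss_density x P \<xi>
    = exp (1/2 * (h \<bullet> (matrix_inv P *v h))) * gauss_density (x + h) P \<xi>"
proof -
  define Q a where "Q = matrix_inv P" and "a = \<xi> - x"
  have sym: "a \<bullet> (Q *v h) = h \<bullet> (Q *v a)"
    using spd_matrix_inv[OF assms] unfolding Q_def spd_def by (metis dot_transpose inner_commute)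
  have a: "\<xi> - (x + h) = a - h" by (simp add: a_def)
  have "h \<bullet> (Q *v a) + - (1/2) * (a \<bullet> (Q *v a))
    = 1/2 * (h \<bullet> (Q *v h)) + - (1/2) * ((a - h) \<bullet> (Q *v (a - h)))"
    by (simp add: matrix_vector_mult_diff_distrib inner_diff_left inner_diff_right sym algebra_simps)
  then have "exp (h \<bullet> (Q *v a)) * exp (- (1/2) * (a \<bullet> (Q *v a)))
    = exp (1/2 * (h \<bullet> (Q *v h))) * exp (- (1/2) * ((a - h) \<bullet> (Q *v (a - h))))"
    by (simp only: exp_add[symmetric])
  then show ?thesis
    unfolding gauss_density_def Q_def[symmetric] a a_def[symmetric] times_divide_eq_right by simp
qed

text \<open>By tilting, the integral at x + h is a scalar prefactor times a Laplace transform in h.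
  Integrability at every centre is the same as integrability of every tilt.\<close>

lemma slr_mean_has_derivative_integral:
  fixes g :: "real^'n \<Rightarrow> 'b::{banach, second_countable_topology}"
  assumes P: "spd P"
    and int: "\<And>x. integrable lborel (\<lambda>\<xi>. gauss_density x P \<xi> *\<^sub>R g \<xi>)"
  shows "integrable lborel (\<lambda>\<xi>. (h \<bullet> (matrix_inv P *v (\<xi> - x))) *\<^sub>R (gauss_density x P \<xi> *\<^sub>R g \<xi>))"
    and "((\<lambda>x. \<integral>\<xi>. gauss_density x P \<xi> *\<^sub>R g \<xi> \<partial>lborel) has_derivative
      (\<lambda>h. \<integral>\<xi>. (h \<bullet> (matrix_inv P *v (\<xi> - x))) *\<^sub>R (gauss_density x P \<xi> *\<^sub>R g \<xi>) \<partial>lborel)) (at x)"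
proof -
  define u where "u \<xi> = matrix_inv P *v (\<xi> - x)" for \<xi>
  define G where "G \<xi> = gauss_density x P \<xi> *\<^sub>R g \<xi>" for \<xi>
  have [measurable]: "u \<in> borel_measurable lborel"
    unfolding u_def by measurable
  have tilt: "exp (h \<bullet> u \<xi>) *\<^sub>R G \<xi>
      = exp (1/2 * (h \<bullet> (matrix_inv P *v h))) *\<^sub>R (gauss_density (x + h) P \<xi> *\<^sub>R g \<xi>)" for h \<xi>
    unfolding u_def G_def scaleR_scaleR gauss_density_tilt[OF P] ..
  have intG: "integrable lborel (\<lambda>\<xi>. exp (h \<bullet> u \<xi>) *\<^sub>R G \<xi>)" for h
    unfolding tilt using int by (intro integrable_scaleR_right)
  show "integrable lborel (\<lambda>\<xi>. (h \<bullet> u \<xi>) *\<^sub>R G \<xi>)"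
    by (rule laplace_transform_derivative(1)[OF intG]) measurable
  define psi where "psi h = (\<integral>\<xi>. exp (h \<bullet> u \<xi>) *\<^sub>R G \<xi> \<partial>lborel)" for h
  define D where "D h = (\<integral>\<xi>. (h \<bullet> u \<xi>) *\<^sub>R G \<xi> \<partial>lborel)" for h
  have psi: "(psi has_derivative D) (at 0)"
    unfolding psi_def D_def by (rule laplace_transform_derivative(2)[OF intG]) measurable
  define e where "e h = exp (- (1/2) * (h \<bullet> (matrix_inv P *v h)))" for h
  \<comment> \<open>The prefactor is even in h with value 1 at 0, so it leaves the derivative of
    \<open>psi\<close> unchanged.\<close>
  have "(e has_derivative (\<lambda>h. 0)) (at 0)"
    unfolding e_def
    by (auto intro!: derivative_eq_intros bounded_linear.has_derivative[OF matrix_vector_mul_bounded_linear])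
  \<comment> \<open>The point 0 is written as x - x so that the chain rule applies with the shift by
    x.\<close>
  from has_derivative_scaleR[OF this psi]
  have "((\<lambda>h. e h *\<^sub>R psi h) has_derivative D) (at (x - x))"
    by (simp add: e_def)
  from has_derivative_compose[OF has_derivative_diff[OF has_derivative_ident has_derivative_const] this]
  have deriv: "((\<lambda>y. e (y - x) *\<^sub>R psi (y - x)) has_derivative D) (at x)"
    by simp
  have "e (y - x) *\<^sub>R psi (y - x) = (\<integral>\<xi>. gauss_density y P \<xi> *\<^sub>R g \<xi> \<partial>lborel)" for y
    unfolding psi_def tilt e_def by (subst integral_scaleR_right) (auto simp: int simp flip: exp_add)
  then show "((\<lambda>x. \<integral>\<xi>. gauss_density x P \<xi> *\<^sub>R g \<xi> \<partial>lborel) has_derivative D) (at x)"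
    using deriv by simp
qed

lemma matrix_vector_mult_minus: "A *v (- x) = - (A *v x)" for A :: "real^'n^'m"
  by (rule linear_neg) simp

text \<open>Integrability is the preceding lemma for a constant function; the value is zero by
  oddness about x.\<close>

lemma gauss_density_centred:
  assumes "spd P"
  shows "integrable lborel (\<lambda>\<xi>. (h \<bullet> (matrix_inv P *v (\<xi> - x))) * gauss_density x P \<xi>)"
    and "(\<integral>\<xi>. (h \<bullet> (matrix_inv P *v (\<xi> - x))) * gauss_density x P \<xi> \<partial>lborel) = 0"
proof -
  show "integrable lborel (\<lambda>\<xi>. (h \<bullet> (matrix_inv P *v (\<xi> - x))) * gauss_density x P \<xi>)"
    using slr_mean_has_derivative_integral(1)[OF assms, of "\<lambda>_. 1::real"] gauss_density_integral(1)[OF assms]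
    by simp
  have "(\<integral>\<xi>. (h \<bullet> (matrix_inv P *v (\<xi> - x))) * gauss_density 0 P (\<xi> - x) \<partial>lborel)
    = (\<integral>\<xi>. (h \<bullet> (matrix_inv P *v \<xi>)) * gauss_density 0 P \<xi> \<partial>lborel)"
    by (rule integral_lborel_translate) measurable
  also have "\<dots> = 0"
    by (rule integral_lborel_odd) (auto simp: gauss_density_def matrix_vector_mult_minus)
  finally show "(\<integral>\<xi>. (h \<bullet> (matrix_inv P *v (\<xi> - x))) * gauss_density x P \<xi> \<partial>lborel) = 0"
    by (simp only: gauss_density_translate[of x])
qed

lemma transpose_outer_vector: "transpose (outer a b) *v k = (a \<bullet> k) *\<^sub>R b"
  by (simp add: outer_def transpose_def matrix_vector_mult_def vec_eq_iff inner_vec_def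
      sum_distrib_left mult_ac)

lemma outer_vector: "outer a b *v k = (b \<bullet> k) *\<^sub>R a"
  by (simp add: outer_def matrix_vector_mult_def vec_eq_iff inner_vec_def
      sum_distrib_left mult_ac)

lemma bounded_linear_transpose_vector: "bounded_linear (\<lambda>A :: real^'m^'n. transpose A *v k)"
  unfolding linear_conv_bounded_linear[symmetric]
  by (rule linearI) (simp_all add: transpose_add matrix_vector_mult_add_rdistrib transpose_scalar
      scaleR_matrix_vector_assoc)

lemma bounded_linear_form: "bounded_linear (\<lambda>A :: real^'m^'n. w \<bullet> (A *v k))"
  unfolding linear_conv_bounded_linear[symmetric]
  by (rule linearI) (simp_all add: matrix_vector_mult_add_rdistrib inner_add_right
      flip: scaleR_matrix_vector_assoc)

text \<open>The regression matrix weights g minus its mean, the derivative weights g itself. The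
  difference is a multiple of a centred first moment of the Gaussian, which vanishes.\<close>

lemma slr_mean_has_derivative:
  assumes P: "spd P" and g: "slr_moments_finite g P"
  shows "(slr_mean g P has_derivative (*v) (slr_mat g P x)) (at x)"
proof -
  have int: "integrable lborel (\<lambda>\<xi>. gauss_density x P \<xi> *\<^sub>R g \<xi>)"
    and int2: "integrable lborel (\<lambda>\<xi>. gauss_density x P \<xi> *\<^sub>R outer (\<xi> - x) (g \<xi> - slr_mean g P x))" for x
    using g unfolding slr_moments_finite_def by auto
  define Q where "Q = matrix_inv P"
  have "slr_mat g P x *v h = (\<integral>\<xi>. (h \<bullet> (Q *v (\<xi> - x))) *\<^sub>R (gauss_density x P \<xi> *\<^sub>R g \<xi>) \<partial>lborel)" for h
  proof -
    have Q: "(\<xi> - x) \<bullet> (Q *v h) = h \<bullet> (Q *v (\<xi> - x))" for \<xi>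
      using spd_matrix_inv[OF P] unfolding Q_def spd_def by (metis dot_transpose inner_commute)
    have "slr_mat g P x *v h = transpose (slr_Psi g P x) *v (Q *v h)"
      by (simp add: slr_mat_def Q_def matrix_vector_mul_assoc)
    also have "\<dots> = (\<integral>\<xi>. transpose (gauss_density x P \<xi> *\<^sub>R outer (\<xi> - x) (g \<xi> - slr_mean g P x)) *v (Q *v h) \<partial>lborel)"
      unfolding slr_Psi_def by (rule integral_bounded_linear[OF bounded_linear_transpose_vector int2, symmetric])
    also have "\<dots> = (\<integral>\<xi>. (h \<bullet> (Q *v (\<xi> - x))) *\<^sub>R (gauss_density x P \<xi> *\<^sub>R g \<xi>)
        - ((h \<bullet> (Q *v (\<xi> - x))) * gauss_density x P \<xi>) *\<^sub>R slr_mean g P x \<partial>lborel)"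
      by (intro Bochner_Integration.integral_cong refl)
        (simp add: transpose_scalar scaleR_matrix_vector_assoc[symmetric] transpose_outer_vector Q
          scaleR_diff_right mult.commute)
    also have "\<dots> = (\<integral>\<xi>. (h \<bullet> (Q *v (\<xi> - x))) *\<^sub>R (gauss_density x P \<xi> *\<^sub>R g \<xi>) \<partial>lborel)
        - (\<integral>\<xi>. (h \<bullet> (Q *v (\<xi> - x))) * gauss_density x P \<xi> \<partial>lborel) *\<^sub>R slr_mean g P x"
      using slr_mean_has_derivative_integral(1)[OF P int, of h x] gauss_density_centred(1)[OF P, of h x]
      unfolding Q_def by (subst Bochner_Integration.integral_diff) auto
    finally show ?thesis
      using gauss_density_centred(2)[OF P, of h x] by (simp add: Q_def)
  qed
  then have "(*v) (slr_mat g P x)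
      = (\<lambda>h. \<integral>\<xi>. (h \<bullet> (Q *v (\<xi> - x))) *\<^sub>R (gauss_density x P \<xi> *\<^sub>R g \<xi>) \<partial>lborel)"
    by (rule ext)
  then show ?thesis
    using slr_mean_has_derivative_integral(2)[OF P int, of x]
    unfolding Q_def slr_mean_def[abs_def] by (simp only:)
qed

section \<open>Gaussian moments and the covariance of the regression residual\<close>

lemma norm_outer: "norm (outer a b) = norm a * norm b"
proof -
  have "norm (outer a b) = L2_set (\<lambda>i. norm (a $ i *\<^sub>R b)) UNIV"
  proof -
    have "outer a b $ i = a $ i *\<^sub>R b" for i
      by (simp add: outer_def vec_eq_iff)
    then show ?thesis by (simp add: norm_vec_def)
  qed
  also have "\<dots> = L2_set (\<lambda>i. norm (a $ i)) UNIV * norm b"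
    by (simp add: L2_set_left_distrib)
  finally show ?thesis by (simp add: norm_vec_def)
qed

lemma borel_measurable_outer_self: "(\<lambda>x. outer (x - m) (x - m)) \<in> borel_measurable borel"
  unfolding outer_def by (intro borel_measurable_continuous_onI continuous_intros)

text \<open>Lets first moments be dominated by the same quadratic bound as second moments.\<close>

lemma norm_le_one_plus_square: "norm y \<le> 1 + (norm y)\<^sup>2"
proof -
  have "2 * norm y \<le> 1 + (norm y)\<^sup>2"
    using zero_le_power2[of "norm y - 1"] unfolding power2_diff by simp
  then show ?thesis using norm_ge_zero[of y] by linarith
qed

text \<open>The identity is treated as one more regressed function: its finite moments give
  integrability of the second moments, and make the derivative formula applicable to it.\<close>

lemma gauss_density_moments:
  assumes "spd P"
  shows "slr_moments_finite (\<lambda>\<xi>. \<xi>) P" "slr_mean (\<lambda>\<xi>. \<xi>) P = (\<lambda>x. x)"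
proof -
  define a where "a = 1 / sqrt ((2 * pi) ^ CARD('a) * det P)"
  have "a > 0" using spd_det_pos[OF assms] by (simp add: a_def)
  have dens: "gauss_density 0 P y = a * exp (- (1/2) * (y \<bullet> (matrix_inv P *v y)))" for y
    by (simp add: gauss_density_def a_def)
  have int1: "integrable lborel (\<lambda>y. gauss_density 0 P y *\<^sub>R y)"
  proof (rule integrable_gauss_quadratic[OF spd_matrix_inv[OF assms], where a = a])
    fix y :: "real^'a"
    show "norm (gauss_density 0 P y *\<^sub>R y) \<le> a * (1 + (norm y)\<^sup>2) * exp (- (1/2) * (y \<bullet> (matrix_inv P *v y)))"
      using \<open>a > 0\<close> norm_le_one_plus_square[of y] unfolding dens norm_scaleR abs_mult by simp
  qed measurable
  have int2: "integrable lborel (\<lambda>y. gauss_density 0 P y *\<^sub>R outer (y - 0) (y - 0))"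
  proof (rule integrable_gauss_quadratic[OF spd_matrix_inv[OF assms], where a = a])
    note borel_measurable_outer_self[measurable]
    show "(\<lambda>y. gauss_density 0 P y *\<^sub>R outer (y - 0) (y - 0)) \<in> borel_measurable borel" by measurable
    fix y :: "real^'a"
    show "norm (gauss_density 0 P y *\<^sub>R outer (y - 0) (y - 0)) \<le> a * (1 + (norm y)\<^sup>2) * exp (- (1/2) * (y \<bullet> (matrix_inv P *v y)))"
      using \<open>a > 0\<close> unfolding dens norm_scaleR abs_mult norm_outer by (simp add: power2_eq_square)
  qed
  have mean_int: "integrable lborel (\<lambda>\<xi>. gauss_density x P \<xi> *\<^sub>R (\<xi> - x))"
    and mean_0: "(\<integral>\<xi>. gauss_density x P \<xi> *\<^sub>R (\<xi> - x) \<partial>lborel) = 0"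
    and outer_int: "integrable lborel (\<lambda>\<xi>. gauss_density x P \<xi> *\<^sub>R outer (\<xi> - x) (\<xi> - x))" for x
  proof -
    note borel_measurable_outer_self[measurable]
    show "integrable lborel (\<lambda>\<xi>. gauss_density x P \<xi> *\<^sub>R (\<xi> - x))"
      unfolding gauss_density_translate[of x]
      by (subst integral_lborel_translate(2)[where f = "\<lambda>y. gauss_density 0 P y *\<^sub>R y"]) (auto intro: int1)
    have "(\<integral>\<xi>. gauss_density 0 P \<xi> *\<^sub>R \<xi> \<partial>lborel) = 0"
      by (rule integral_lborel_odd) (auto simp: gauss_density_def matrix_vector_mult_minus)
    then show "(\<integral>\<xi>. gauss_density x P \<xi> *\<^sub>R (\<xi> - x) \<partial>lborel) = 0"
      unfolding gauss_density_translate[of x]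
      by (subst integral_lborel_translate(1)[where f = "\<lambda>y. gauss_density 0 P y *\<^sub>R y"]) auto
    show "integrable lborel (\<lambda>\<xi>. gauss_density x P \<xi> *\<^sub>R outer (\<xi> - x) (\<xi> - x))"
      unfolding gauss_density_translate[of x]
      using integral_lborel_translate(2)[where f = "\<lambda>y. gauss_density 0 P y *\<^sub>R outer (y - 0) (y - 0)" and c = x] int2
      by simp
  qed
  have split: "gauss_density x P \<xi> *\<^sub>R \<xi> = gauss_density x P \<xi> *\<^sub>R (\<xi> - x) + gauss_density x P \<xi> *\<^sub>R x" for x \<xi>
    by (simp add: scaleR_diff_right)
  have int: "integrable lborel (\<lambda>\<xi>. gauss_density x P \<xi> *\<^sub>R \<xi>)" for x
    unfolding split[of x] using mean_int gauss_density_integral(1)[OF assms]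
    by (intro Bochner_Integration.integrable_add integrable_scaleR_left)
  have mean: "slr_mean (\<lambda>\<xi>. \<xi>) P x = x" for x
    unfolding slr_mean_def split[of x] using mean_int mean_0 gauss_density_integral[OF assms]
    by (subst Bochner_Integration.integral_add) (auto simp: integrable_scaleR_left)
  show "slr_mean (\<lambda>\<xi>. \<xi>) P = (\<lambda>x. x)" using mean by blast
  show "slr_moments_finite (\<lambda>\<xi>. \<xi>) P"
    unfolding slr_moments_finite_def mean using int outer_int by simp
qed

text \<open>The mean of N(x, P) is x, and its derivative in x is \<open>\<Psi>\<^sup>T P\<^sup>-\<^sup>1\<close>, so that \<open>\<Psi> = P\<close>.\<close>

lemma slr_Psi_ident:
  assumes "spd P"
  shows "slr_Psi (\<lambda>\<xi>. \<xi>) P x = P"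
proof -
  have "((\<lambda>x. x) has_derivative (*v) (slr_mat (\<lambda>\<xi>. \<xi>) P x)) (at x)"
    using slr_mean_has_derivative[OF assms gauss_density_moments(1)[OF assms], of x]
    by (simp only: gauss_density_moments(2)[OF assms])
  then have "(*v) (slr_mat (\<lambda>\<xi>. \<xi>) P x) = (\<lambda>h. h)"
    using has_derivative_unique has_derivative_ident by blast
  then have "slr_mat (\<lambda>\<xi>. \<xi>) P x = mat 1"
    by (simp add: matrix_eq fun_eq_iff)
  then have "transpose (slr_Psi (\<lambda>\<xi>. \<xi>) P x) ** matrix_inv P ** P = P"
    by (simp add: slr_mat_def)
  then have "transpose (slr_Psi (\<lambda>\<xi>. \<xi>) P x) = P"
    by (simp add: matrix_mul_assoc[symmetric] spd_inv_mult[OF assms])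
  then show ?thesis
    using assms unfolding spd_def by (metis transpose_transpose)
qed

text \<open>Passing to bilinear forms turns matrix-valued integrals into scalar ones, where a square
  can be expanded and reassembled.\<close>

lemma integral_outer_form:
  assumes "integrable M (\<lambda>\<xi>. p \<xi> *\<^sub>R outer (a \<xi>) (b \<xi>))"
  shows "integrable M (\<lambda>\<xi>. p \<xi> * ((a \<xi> \<bullet> w) * (b \<xi> \<bullet> v)))"
    and "(\<integral>\<xi>. p \<xi> * ((a \<xi> \<bullet> w) * (b \<xi> \<bullet> v)) \<partial>M) = w \<bullet> ((\<integral>\<xi>. p \<xi> *\<^sub>R outer (a \<xi>) (b \<xi>) \<partial>M) *v v)"
proof -
  have *: "w \<bullet> ((p \<xi> *\<^sub>R outer (a \<xi>) (b \<xi>)) *v v) = p \<xi> * ((a \<xi> \<bullet> w) * (b \<xi> \<bullet> v))" for \<xi>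
    by (simp add: scaleR_matrix_vector_assoc[symmetric] outer_vector inner_commute)
  show "integrable M (\<lambda>\<xi>. p \<xi> * ((a \<xi> \<bullet> w) * (b \<xi> \<bullet> v)))"
    using integrable_bounded_linear[OF bounded_linear_form[of w v] assms] unfolding * .
  show "(\<integral>\<xi>. p \<xi> * ((a \<xi> \<bullet> w) * (b \<xi> \<bullet> v)) \<partial>M) = w \<bullet> ((\<integral>\<xi>. p \<xi> *\<^sub>R outer (a \<xi>) (b \<xi>) \<partial>M) *v v)"
    using integral_bounded_linear[OF bounded_linear_form[of w v] assms] unfolding * .
qed

text \<open>\<open>slr_cov\<close> is the covariance of the regression residual \<open>g \<xi> - slr_mean g P x - F (\<xi> - x)\<close>.\<close>

lemma slr_cov_psd:
  fixes g :: "real^'n \<Rightarrow> real^'m"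
  assumes P: "spd P" and g: "slr_moments_finite g P"
  shows "psd (slr_cov g P x)"
proof -
  define F where "F = slr_mat g P x"
  define p where "p = gauss_density x P"
  define b where "b \<xi> = g \<xi> - slr_mean g P x" for \<xi>
  have symP: "transpose P = P" "transpose (matrix_inv P) = matrix_inv P"
    using P spd_matrix_inv[OF P] by (auto simp: spd_def)
  have intab: "integrable lborel (\<lambda>\<xi>. p \<xi> *\<^sub>R outer (\<xi> - x) (b \<xi>))"
    and intbb: "integrable lborel (\<lambda>\<xi>. p \<xi> *\<^sub>R outer (b \<xi>) (b \<xi>))"
    and intaa: "integrable lborel (\<lambda>\<xi>. p \<xi> *\<^sub>R outer (\<xi> - x) (\<xi> - x))"
    using g gauss_density_moments(1)[OF P] unfolding slr_moments_finite_def p_def b_def gauss_density_moments(2)[OF P]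
    by auto
  have Psi: "(\<integral>\<xi>. p \<xi> *\<^sub>R outer (\<xi> - x) (b \<xi>) \<partial>lborel) = slr_Psi g P x"
    and Phi: "(\<integral>\<xi>. p \<xi> *\<^sub>R outer (b \<xi>) (b \<xi>) \<partial>lborel) = slr_Phi g P x"
    and PP: "(\<integral>\<xi>. p \<xi> *\<^sub>R outer (\<xi> - x) (\<xi> - x) \<partial>lborel) = P"
    using slr_Psi_ident[OF P, of x]
    by (simp_all add: slr_Psi_def slr_Phi_def p_def b_def gauss_density_moments(2)[OF P])
  have symPhi: "transpose (slr_Phi g P x) = slr_Phi g P x"
  proof -
    \<comment> \<open>Exchanging v and w only permutes scalar factors under the integral; unit
      vectors then recover the entries.\<close>
    have "w \<bullet> (slr_Phi g P x *v v) = v \<bullet> (slr_Phi g P x *v w)" for v w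
      unfolding Phi[symmetric] integral_outer_form(2)[OF intbb, symmetric] by (simp add: mult.commute)
    then have "slr_Phi g P x $ i $ j = slr_Phi g P x $ j $ i" for i j
      by (metis inner_axis_matrix)
    then show ?thesis by (simp add: transpose_def vec_eq_iff)
  qed
  have "transpose (slr_cov g P x) = slr_cov g P x"
  proof -
    have "transpose (A - B) = transpose A - transpose B" for A B :: "real^'m^'m"
      by (simp add: transpose_def vec_eq_iff)
    then show ?thesis
      by (simp add: slr_cov_def symPhi matrix_transpose_mul symP matrix_mul_assoc)
  qed
  moreover have "0 \<le> v \<bullet> (slr_cov g P x *v v)" for v
  proof -
    define w where "w = transpose F *v v"
    \<comment> \<open>Since F = Psi^T P^-1, these are the normal equations of the regression. They
      turn the cross term of the square into -2 w . P w, of which the last term cancels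
      half.\<close>
    have "slr_Psi g P x *v v = P *v w"
    proof -
      have "P *v w = (P ** matrix_inv P ** slr_Psi g P x) *v v"
        by (simp add: w_def F_def slr_mat_def matrix_transpose_mul symP matrix_vector_mul_assoc
            matrix_mul_assoc)
      then show ?thesis by (simp add: spd_inv_mult[OF P])
    qed
    then have Psi_v: "w \<bullet> (slr_Psi g P x *v v) = w \<bullet> (P *v w)" by simp
    \<comment> \<open>The square is that of the regression residual in direction v, because v . F
      (xi - x) = (xi - x) . w.\<close>
    have "0 \<le> (\<integral>\<xi>. p \<xi> * (b \<xi> \<bullet> v - (\<xi> - x) \<bullet> w)\<^sup>2 \<partial>lborel)"
      using gauss_density_pos[OF P] by (intro Bochner_Integration.integral_nonneg) (simp add: p_def less_imp_le)
    also have "\<dots> = (\<integral>\<xi>. p \<xi> * ((b \<xi> \<bullet> v) * (b \<xi> \<bullet> v)) - 2 * (p \<xi> * (((\<xi> - x) \<bullet> w) * (b \<xi> \<bullet> v)))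
        + p \<xi> * (((\<xi> - x) \<bullet> w) * ((\<xi> - x) \<bullet> w)) \<partial>lborel)"
      by (intro Bochner_Integration.integral_cong refl) (simp add: power2_eq_square algebra_simps)
    also have "\<dots> = v \<bullet> (slr_Phi g P x *v v) - 2 * (w \<bullet> (slr_Psi g P x *v v)) + w \<bullet> (P *v w)"
      using integral_outer_form(1)[OF intab, of w v] integral_outer_form(1)[OF intbb, of v v]
        integral_outer_form(1)[OF intaa, of w w]
      by (simp add: integral_outer_form(2)[OF intab] integral_outer_form(2)[OF intbb]
          integral_outer_form(2)[OF intaa] Psi Phi PP)
    also have "\<dots> = v \<bullet> (slr_Phi g P x *v v) - w \<bullet> (P *v w)"
      by (simp add: Psi_v)
    also have "\<dots> = v \<bullet> (slr_cov g P x *v v)"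
    proof -
      have "v \<bullet> ((F ** P ** transpose F) *v v) = w \<bullet> (P *v w)"
        by (simp add: w_def dot_transpose matrix_vector_mul_assoc matrix_mul_assoc)
      then show ?thesis
        by (simp add: slr_cov_def F_def matrix_vector_mult_diff_rdistrib inner_diff_right)
    qed
    finally show ?thesis .
  qed
  ultimately show ?thesis by (simp add: psd_def)
qed

section \<open>Stacked trajectories and residuals\<close>

lemma block_add: "block tm (x + z) k = block tm x k + block tm z k"
  and block_diff: "block tm (x - z) k = block tm x k - block tm z k"
  and block_scaleR: "block tm (c *\<^sub>R x) k = c *\<^sub>R block tm x k"
  by (simp_all add: block_def vec_eq_iff)

lemma bounded_linear_block: "bounded_linear (\<lambda>x. block tm x k)"
  unfolding linear_conv_bounded_linear[symmetric]
  by (rule linearI) (simp_all add: block_add block_scaleR)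

lemma the_inv_into_bij:
  assumes "bij_betw f A UNIV"
  shows "the_inv_into A f i \<in> A" "f (the_inv_into A f i) = i"
  using assms the_inv_into_into[of f A i A] f_the_inv_into_f[of f A i] by (auto simp: bij_betw_def)

lemma stack_cong:
  assumes "\<And>k. k \<in> {1..K} \<Longrightarrow> f k = g k" "bij_betw tm {1..K} UNIV"
  shows "stack K tm f = stack K tm g"
  by (simp only: stack_def assms(1)[OF the_inv_into_bij(1)[OF assms(2)]])

lemma stack_add: "stack K tm f + stack K tm g = stack K tm (\<lambda>k. f k + g k)"
  by (simp add: stack_def vec_eq_iff)

context
  fixes K :: nat and tm :: "nat \<Rightarrow> 'k::finite"
  assumes bij: "bij_betw tm {1..K} UNIV"
begin

lemma block_stack: "k \<in> {1..K} \<Longrightarrow> block tm (stack K tm f) k = f k"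
  using bij by (simp add: block_def stack_def vec_eq_iff bij_betw_def the_inv_into_f_f)

lemma stack_block: "stack K tm (block tm x) = x"
  by (simp only: block_def stack_def vec_eq_iff vec_lambda_beta the_inv_into_bij[OF bij] prod.collapse simp_thms)

lemma block_eqI: "(\<And>k. k \<in> {1..K} \<Longrightarrow> block tm x k = block tm z k) \<Longrightarrow> x = z"
  using stack_cong[of K "block tm x" "block tm z" tm] bij by (simp add: stack_block)

lemma inner_block: "x \<bullet> z = (\<Sum>k\<in>{1..K}. block tm x k \<bullet> block tm z k)"
proof -
  have "x \<bullet> z = (\<Sum>i\<in>UNIV. \<Sum>j\<in>UNIV. x $ (i, j) * z $ (i, j))"
    by (simp add: inner_vec_def sum.cartesian_product)
  also have "\<dots> = (\<Sum>k\<in>{1..K}. \<Sum>j\<in>UNIV. x $ (tm k, j) * z $ (tm k, j))"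
    by (rule sum.reindex_bij_betw[OF bij, symmetric])
  finally show ?thesis by (simp add: block_def inner_vec_def)
qed

lemma norm_stack: "(norm (stack K tm f))\<^sup>2 = (\<Sum>k\<in>{1..K}. (norm (f k))\<^sup>2)"
  unfolding power2_norm_eq_inner inner_block by (intro sum.cong refl) (simp add: block_stack)

lemma block_block_diag:
  assumes "k \<in> {1..K}"
  shows "block tm (block_diag K tm S *v x) k = S k *v block tm x k"
proof -
  have inv: "the_inv_into {1..K} tm (tm k) = k"
    using bij assms by (simp add: bij_betw_def the_inv_into_f_f)
  have "(block_diag K tm S *v x) $ (tm k, j) = (S k *v block tm x k) $ j" for j
  proof -
    have "(block_diag K tm S *v x) $ (tm k, j)
      = (\<Sum>i\<in>UNIV. \<Sum>l\<in>UNIV. (if tm k = i then S k $ j $ l else 0) * x $ (i, l))"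
      using inv by (auto simp: matrix_vector_mult_def block_diag_def sum.cartesian_product
          case_prod_unfold intro!: sum.cong)
    also have "\<dots> = (\<Sum>i\<in>UNIV. if tm k = i then (\<Sum>l\<in>UNIV. S k $ j $ l * x $ (i, l)) else 0)"
      by (intro sum.cong refl) simp
    also have "\<dots> = (\<Sum>l\<in>UNIV. S k $ j $ l * x $ (tm k, l))"
      by simp
    finally show ?thesis by (simp add: matrix_vector_mult_def block_def)
  qed
  then show ?thesis by (simp add: block_def vec_eq_iff)
qed

text \<open>Inversion acts blockwise, so the joint regulariser splits into one term per time, as the
  additional measurements do.\<close>

lemma inner_block_diag_inv:
  fixes S :: "nat \<Rightarrow> real^'n^'n"
  assumes S: "\<And>k. k \<in> {1..K} \<Longrightarrow> spd (S k)"
  shows "x \<bullet> (matrix_inv (block_diag K tm S) *v x)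
    = (\<Sum>k\<in>{1..K}. block tm x k \<bullet> (matrix_inv (S k) *v block tm x k))"
proof -
  have "block_diag K tm S ** block_diag K tm (\<lambda>k. matrix_inv (S k)) = mat 1"
    unfolding matrix_eq matrix_vector_mul_assoc[symmetric] matrix_vector_mul_lid
    by (intro allI block_eqI) (simp only: block_block_diag spd_inv_vec S)
  then have "matrix_inv (block_diag K tm S) = block_diag K tm (\<lambda>k. matrix_inv (S k))"
    by (rule matrix_inv_unique)
  then show ?thesis
    unfolding inner_block by (intro sum.cong refl) (simp only: block_block_diag)
qed

text \<open>Each component of the stack is a component of a single \<open>f k\<close>, with k in
  range because tm is a bijection.\<close>

lemma has_derivative_stack:
  assumes "\<And>k. k \<in> {1..K} \<Longrightarrow> (f k has_derivative f' k) (at x)"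
  shows "((\<lambda>x. stack K tm (\<lambda>k. f k x)) has_derivative (\<lambda>h. stack K tm (\<lambda>k. f' k h))) (at x)"
  unfolding has_derivative_componentwise_within[of "\<lambda>x. stack K tm (\<lambda>k. f k x)"]
proof
  fix b :: "real^('k \<times> 'b)"
  assume "b \<in> Basis"
  then obtain p where b: "b = axis p 1" by (auto simp: Basis_real_vec)
  from bounded_linear.has_derivative[OF bounded_linear_vec_nth assms[OF the_inv_into_bij(1)[OF bij]]]
  show "((\<lambda>x. stack K tm (\<lambda>k. f k x) \<bullet> b) has_derivative (\<lambda>h. stack K tm (\<lambda>k. f' k h) \<bullet> b)) (at x)"
    by (simp add: b inner_axis stack_def)
qed

text \<open>The predictions u and v are arbitrary, so the identity serves both the original cost and
  its affine surrogate.\<close>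

lemma L_LM_residual:
  assumes S: "\<And>k. k \<in> {1..K} \<Longrightarrow> spd (S k)"
    and W0: "W0 ** transpose W0 = matrix_inv P0"
    and WQ: "\<And>k. k \<in> {1..<K} \<Longrightarrow> WQ k ** transpose (WQ k) = matrix_inv (Qc k)"
    and WR: "\<And>k. k \<in> {1..K} \<Longrightarrow> WR k ** transpose (WR k) = matrix_inv (Rc k)"
    and WS: "WS ** transpose WS = lam *\<^sub>R matrix_inv (block_diag K tm S)"
  shows "L_LM K tm (smoothing_cost K tm m0 P0 u Qc v Rc y) lam S xh x
    = 1/2 * (norm (lm_residual K tm m0 W0 u WQ v WR y WS xh x))\<^sup>2"
proof -
  define d where "d k = block tm x (k + 1) - u k (block tm x k)" for k
  define r where "r k = y k - v k (block tm x k)" for k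
  have norm4: "(norm (a, b, c, e))\<^sup>2 = (norm a)\<^sup>2 + (norm b)\<^sup>2 + (norm c)\<^sup>2 + (norm e)\<^sup>2"
    for a :: "real^'a" and b :: "real^('k \<times> 'a)" and c :: "real^('k \<times> 'b)" and e :: "real^('k \<times> 'a)"
    by (simp add: norm_Pair)
  have "(norm (stack K tm (\<lambda>k. if k < K then transpose (WQ k) *v d k else 0)))\<^sup>2
    = (\<Sum>k\<in>{1..K}. if k < K then d k \<bullet> (matrix_inv (Qc k) *v d k) else 0)"
    unfolding norm_stack by (intro sum.cong refl) (simp add: root_norm[OF WQ])
  \<comment> \<open>The padded slot K contributes 0, which leaves the K - 1 motion terms.\<close>
  also have "\<dots> = (\<Sum>k\<in>{1..<K}. d k \<bullet> (matrix_inv (Qc k) *v d k))"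
    by (intro sum.mono_neutral_cong_right) auto
  finally have motion: "(norm (stack K tm (\<lambda>k. if k < K then transpose (WQ k) *v d k else 0)))\<^sup>2
    = (\<Sum>k\<in>{1..<K}. d k \<bullet> (matrix_inv (Qc k) *v d k))" .
  have obs: "(norm (stack K tm (\<lambda>k. transpose (WR k) *v r k)))\<^sup>2
    = (\<Sum>k\<in>{1..K}. r k \<bullet> (matrix_inv (Rc k) *v r k))"
    unfolding norm_stack by (intro sum.cong refl) (simp add: root_norm[OF WR])
  have reg: "lam * ((x - xh) \<bullet> (matrix_inv (block_diag K tm S) *v (x - xh))) = (norm (transpose WS *v (x - xh)))\<^sup>2"
    unfolding root_norm[OF WS, symmetric] by (simp flip: scaleR_matrix_vector_assoc)
  show ?thesis
    unfolding L_LM_def smoothing_cost_def lm_residual_def norm4 mult.assoc reg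
      d_def[symmetric] r_def[symmetric] motion obs root_norm[OF W0]
    by (simp add: algebra_simps)
qed

text \<open>The offsets b and c make the affine predictions agree with u and v at the current
  blocks, so the affine residual is tangent to the original one at xh. The last claim exposes the
  regularisation component of J, the source of its injectivity.\<close>

lemma lm_residual_linearised:
  assumes u: "\<And>k. k \<in> {1..<K} \<Longrightarrow> (u k has_derivative (*v) (F k)) (at (block tm xh k))"
    and b: "\<And>k. k \<in> {1..<K} \<Longrightarrow> b k = u k (block tm xh k) - F k *v block tm xh k"
    and v: "\<And>k. k \<in> {1..K} \<Longrightarrow> (v k has_derivative (*v) (H k)) (at (block tm xh k))"
    and c: "\<And>k. k \<in> {1..K} \<Longrightarrow> c k = v k (block tm xh k) - H k *v block tm xh k"
  obtains J where
    "(lm_residual K tm m0 W0 u WQ v WR y WS xh has_derivative J) (at xh)"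
    "\<And>x. lm_residual K tm m0 W0 (\<lambda>k z. F k *v z + b k) WQ (\<lambda>k z. H k *v z + c k) WR y WS xh x
        = lm_residual K tm m0 W0 u WQ v WR y WS xh xh + J (x - xh)"
    "\<And>h. snd (snd (snd (J h))) = transpose WS *v h"
proof
  let ?J = "\<lambda>h. (transpose W0 *v block tm h 1,
      stack K tm (\<lambda>k. if k < K then transpose (WQ k) *v (block tm h (k + 1) - F k *v block tm h k) else 0),
      stack K tm (\<lambda>k. transpose (WR k) *v (- (H k *v block tm h k))),
      transpose WS *v h)"
  note blk = bounded_linear.has_derivative[OF bounded_linear_block has_derivative_ident]
  note mv = bounded_linear.has_derivative[OF matrix_vector_mul_bounded_linear]
  show "(lm_residual K tm m0 W0 u WQ v WR y WS xh has_derivative ?J) (at xh)"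
    unfolding lm_residual_def[abs_def]
  proof (intro has_derivative_Pair has_derivative_stack)
    show "((\<lambda>x. transpose W0 *v (block tm x 1 - m0)) has_derivative (\<lambda>h. transpose W0 *v block tm h 1)) (at xh)"
      using mv[OF has_derivative_diff[OF blk has_derivative_const]] by simp
    show "((\<lambda>x. transpose WS *v (x - xh)) has_derivative (\<lambda>h. transpose WS *v h)) (at xh)"
      using mv[OF has_derivative_diff[OF has_derivative_ident has_derivative_const]] by simp
    fix k
    assume k: "k \<in> {1..K}"
    show "((\<lambda>x. transpose (WR k) *v (y k - v k (block tm x k))) has_derivative
        (\<lambda>h. transpose (WR k) *v (- (H k *v block tm h k)))) (at xh)"
      using mv[OF has_derivative_diff[OF has_derivative_const has_derivative_compose[OF blk v[OF k]]]] by simp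
    show "((\<lambda>x. if k < K then transpose (WQ k) *v (block tm x (k + 1) - u k (block tm x k)) else 0) has_derivative
        (\<lambda>h. if k < K then transpose (WQ k) *v (block tm h (k + 1) - F k *v block tm h k) else 0)) (at xh)"
    proof (cases "k < K")
      case True
      with k have "k \<in> {1..<K}" by simp
      from mv[OF has_derivative_diff[OF blk has_derivative_compose[OF blk u[OF this]]]] True
      show ?thesis by simp
    qed simp
  qed
  fix x
  show "lm_residual K tm m0 W0 (\<lambda>k z. F k *v z + b k) WQ (\<lambda>k z. H k *v z + c k) WR y WS xh x
        = lm_residual K tm m0 W0 u WQ v WR y WS xh xh + ?J (x - xh)"
    unfolding lm_residual_def plus_prod_def fst_conv snd_conv stack_add prod.inject
  proof (intro conjI stack_cong[OF _ bij])
    fix k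
    assume k: "k \<in> {1..K}"
    show "transpose (WR k) *v (y k - (H k *v block tm x k + c k))
      = transpose (WR k) *v (y k - v k (block tm xh k)) + transpose (WR k) *v (- (H k *v block tm (x - xh) k))"
      unfolding matrix_vector_right_distrib[symmetric] c[OF k]
      by (rule arg_cong[where f = "(*v) (transpose (WR k))"]) (simp add: block_diff matrix_vector_mult_diff_distrib)
    show "(if k < K then transpose (WQ k) *v (block tm x (k + 1) - (F k *v block tm x k + b k)) else 0)
      = (if k < K then transpose (WQ k) *v (block tm xh (k + 1) - u k (block tm xh k)) else 0)
      + (if k < K then transpose (WQ k) *v (block tm (x - xh) (k + 1) - F k *v block tm (x - xh) k) else 0)"
    proof (cases "k < K")
      case True
      with k have b: "b k = u k (block tm xh k) - F k *v block tm xh k" by (intro b) simp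
      show ?thesis
        unfolding b if_P[OF True] matrix_vector_right_distrib[symmetric]
        by (rule arg_cong[where f = "(*v) (transpose (WQ k))"]) (simp add: block_diff matrix_vector_mult_diff_distrib)
    qed simp
  qed (simp_all add: block_diff matrix_vector_mult_diff_distrib)
qed simp

end

section \<open>The joint density up to a positive constant\<close>

lemma gauss_density_proportional:
  fixes P :: "real^'a^'a"
  shows "spd P \<Longrightarrow> \<exists>c>0. \<forall>x. gauss_density m P x = c * exp (- (1/2) * ((x - m) \<bullet> (matrix_inv P *v (x - m))))"
  by (rule exI[of _ "1 / sqrt ((2 * pi) ^ CARD('a) * det P)"]) (simp add: gauss_density_def spd_det_pos)

text \<open>Densities are tracked only up to positive constants, which cancel when the posterior is
  normalised.\<close>

lemma prod_proportional_exp: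
  fixes f q :: "'i \<Rightarrow> 'a \<Rightarrow> real"
  assumes "\<And>k. k \<in> I \<Longrightarrow> \<exists>c>0. \<forall>x. f k x = c * exp (- (1/2) * q k x)" "finite I"
  shows "\<exists>c>0. \<forall>x. (\<Prod>k\<in>I. f k x) = c * exp (- (1/2) * (\<Sum>k\<in>I. q k x))"
proof -
  obtain c where c: "\<And>k. k \<in> I \<Longrightarrow> c k > 0" "\<And>k x. k \<in> I \<Longrightarrow> f k x = c k * exp (- (1/2) * q k x)"
    using assms(1) by metis
  have "(\<Prod>k\<in>I. f k x) = (\<Prod>k\<in>I. c k) * exp (- (1/2) * (\<Sum>k\<in>I. q k x))" for x
    by (simp add: c(2) prod.distrib sum_distrib_left exp_sum assms(2))
  moreover have "(\<Prod>k\<in>I. c k) > 0" using c(1) by (rule prod_pos)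
  ultimately show ?thesis by blast
qed

lemma mult_proportional_exp:
  fixes f g p q :: "'a \<Rightarrow> real"
  assumes "\<exists>c>0. \<forall>x. f x = c * exp (- (1/2) * p x)" "\<exists>c>0. \<forall>x. g x = c * exp (- (1/2) * q x)"
  shows "\<exists>c>0. \<forall>x. f x * g x = c * exp (- (1/2) * (p x + q x))"
proof -
  obtain a b where "a > 0" "\<And>x. f x = a * exp (- (1/2) * p x)" "b > 0" "\<And>x. g x = b * exp (- (1/2) * q x)"
    using assms by blast
  moreover from this have "f x * g x = a * b * exp (- (1/2) * (p x + q x))" for x
    unfolding distrib_left exp_add by simp
  ultimately show ?thesis
    by (intro exI[of _ "a * b"]) simp
qed

lemma joint_density_proportional:
  fixes tm :: "nat \<Rightarrow> 'k::finite" and M :: "('dx::finite, 'dy::finite) ssm"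
  assumes bij: "bij_betw tm {1..K} UNIV"
    and P0: "spd (init_cov M)"
    and Q: "\<And>k. k \<in> {1..<K} \<Longrightarrow> spd (motion_cov M k)" "\<And>k. k \<in> {1..<K} \<Longrightarrow> psd (lin_Omega A k)"
    and R: "\<And>k. k \<in> {1..K} \<Longrightarrow> spd (obs_cov M k)" "\<And>k. k \<in> {1..K} \<Longrightarrow> psd (lin_Gamma A k)"
    and S: "\<And>k. k \<in> {1..K} \<Longrightarrow> spd (S k)" and lam: "lam > 0"
    and Qc: "\<And>k. k \<in> {1..<K} \<Longrightarrow> Qc k = motion_cov M k + lin_Omega A k"
    and Rc: "\<And>k. k \<in> {1..K} \<Longrightarrow> Rc k = obs_cov M k + lin_Gamma A k"
  shows "\<exists>c>0. \<forall>x. joint_density K tm M A (\<lambda>k. (1 / lam) *\<^sub>R S k) y (block tm xh) x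
    = c * exp (- L_LM K tm (smoothing_cost K tm (init_mean M) (init_cov M)
        (\<lambda>k z. lin_F A k *v z + lin_b A k) Qc (\<lambda>k z. lin_H A k *v z + lin_c A k) Rc y) lam S xh x)"
proof -
  define d where "d k x = block tm x (k + 1) - (lin_F A k *v block tm x k + lin_b A k)" for k x
  define r where "r k x = y k - (lin_H A k *v block tm x k + lin_c A k)" for k x
  define e where "e k x = block tm xh k - block tm x k" for k x
  define q0 where "q0 x = (block tm x 1 - init_mean M) \<bullet> (matrix_inv (init_cov M) *v (block tm x 1 - init_mean M))" for x
  have 1: "\<exists>c>0. \<forall>x. gauss_density (init_mean M) (init_cov M) (block tm x 1) = c * exp (- (1/2) * q0 x)"
    using gauss_density_proportional[OF P0, of "init_mean M"] unfolding q0_def by blast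
  have 2: "\<exists>c>0. \<forall>x. (\<Prod>k\<in>{1..<K}. noise_density (lin_Omega A k) (motion_cov M k) (d k x))
      = c * exp (- (1/2) * (\<Sum>k\<in>{1..<K}. d k x \<bullet> (matrix_inv (Qc k) *v d k x)))"
  proof (intro prod_proportional_exp)
    fix k
    assume k: "k \<in> {1..<K}"
    show "\<exists>c>0. \<forall>x. noise_density (lin_Omega A k) (motion_cov M k) (d k x)
        = c * exp (- (1/2) * (d k x \<bullet> (matrix_inv (Qc k) *v d k x)))"
      using noise_density_gauss[OF Q(1)[OF k] Q(2)[OF k]] unfolding Qc[OF k] by blast
  qed simp
  have 3: "\<exists>c>0. \<forall>x. (\<Prod>k\<in>{1..K}. noise_density (lin_Gamma A k) (obs_cov M k) (r k x))
      = c * exp (- (1/2) * (\<Sum>k\<in>{1..K}. r k x \<bullet> (matrix_inv (Rc k) *v r k x)))"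
  proof (intro prod_proportional_exp)
    fix k
    assume k: "k \<in> {1..K}"
    show "\<exists>c>0. \<forall>x. noise_density (lin_Gamma A k) (obs_cov M k) (r k x)
        = c * exp (- (1/2) * (r k x \<bullet> (matrix_inv (Rc k) *v r k x)))"
      using noise_density_gauss[OF R(1)[OF k] R(2)[OF k]] unfolding Rc[OF k] by blast
  qed simp
  have 4: "\<exists>c>0. \<forall>x. (\<Prod>k\<in>{1..K}. gauss_density 0 ((1 / lam) *\<^sub>R S k) (e k x))
      = c * exp (- (1/2) * (\<Sum>k\<in>{1..K}. lam * (e k x \<bullet> (matrix_inv (S k) *v e k x))))"
  proof (intro prod_proportional_exp)
    fix k
    assume k: "k \<in> {1..K}"
    \<comment> \<open>Dividing the covariance by lam multiplies its weight by lam: this is the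
      Levenberg-Marquardt factor.\<close>
    then have "matrix_inv ((1 / lam) *\<^sub>R S k) = lam *\<^sub>R matrix_inv (S k)"
      using lam by (simp add: matrix_inv_scaleR S)
    moreover have "spd ((1 / lam) *\<^sub>R S k)"
      using lam k by (intro spd_scaleR S) auto
    ultimately show "\<exists>c>0. \<forall>x. gauss_density 0 ((1 / lam) *\<^sub>R S k) (e k x)
        = c * exp (- (1/2) * (lam * (e k x \<bullet> (matrix_inv (S k) *v e k x))))"
      using gauss_density_proportional[of "(1 / lam) *\<^sub>R S k" 0] by (auto simp flip: scaleR_matrix_vector_assoc)
  qed simp
  have reg: "(\<Sum>k\<in>{1..K}. lam * (e k x \<bullet> (matrix_inv (S k) *v e k x)))
      = lam * ((x - xh) \<bullet> (matrix_inv (block_diag K tm S) *v (x - xh)))" for x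
  proof -
    \<comment> \<open>The residual of the additional measurement is minus a block of x - xh, and the
      quadratic form ignores the sign.\<close>
    have "e k x \<bullet> (matrix_inv (S k) *v e k x) = block tm (x - xh) k \<bullet> (matrix_inv (S k) *v block tm (x - xh) k)" for k
    proof -
      have "e k x = - block tm (x - xh) k" by (simp add: e_def block_diff)
      then show ?thesis by (simp add: matrix_vector_mult_minus)
    qed
    then show ?thesis
      by (subst inner_block_diag_inv[OF bij]) (auto simp: S sum_distrib_left)
  qed
  have L: "L_LM K tm (smoothing_cost K tm (init_mean M) (init_cov M)
        (\<lambda>k z. lin_F A k *v z + lin_b A k) Qc (\<lambda>k z. lin_H A k *v z + lin_c A k) Rc y) lam S xh x
    = 1/2 * (q0 x + (\<Sum>k\<in>{1..<K}. d k x \<bullet> (matrix_inv (Qc k) *v d k x))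
        + (\<Sum>k\<in>{1..K}. r k x \<bullet> (matrix_inv (Rc k) *v r k x))
        + (\<Sum>k\<in>{1..K}. lam * (e k x \<bullet> (matrix_inv (S k) *v e k x))))" for x
    unfolding L_LM_def smoothing_cost_def reg q0_def d_def r_def by (simp add: algebra_simps)
  show ?thesis
    using mult_proportional_exp[OF mult_proportional_exp[OF mult_proportional_exp[OF 1 2] 3] 4]
    unfolding joint_density_def L d_def[symmetric] r_def[symmetric] e_def[symmetric] by simp
qed

section \<open>Least squares and the mean of a Gaussian\<close>

lemma least_squares_solution:
  fixes J :: "'a::euclidean_space \<Rightarrow> 'b::euclidean_space"
  assumes "linear J"
  obtains z where "\<And>x. (norm (r + J (x - x0)))\<^sup>2 = (norm (r + J (z - x0)))\<^sup>2 + (norm (J (x - z)))\<^sup>2"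
proof -
  \<comment> \<open>Projecting -r onto the range of J leaves w orthogonal to that range. With p = J
    d the minimiser is x0 + d, and the identity is Pythagoras.\<close>
  obtain p w where p: "p \<in> span (range J)" and w: "\<And>s. s \<in> span (range J) \<Longrightarrow> orthogonal w s" and r: "- r = p + w"
    using orthogonal_subspace_decomp_exists[of "range J" "- r"] by metis
  have "span (range J) = range J"
    by (intro span_eq_iff[THEN iffD2] linear_subspace_image assms subspace_UNIV)
  with p obtain d where d: "p = J d" by auto
  have rw: "r + J d = - w" using r d by (metis add.commute add_diff_cancel_left' diff_minus_eq_add minus_diff_eq)
  have "r + J (x - x0) = - w + J (x - (x0 + d))" for x
    unfolding rw[symmetric] using assms by (simp add: linear_diff linear_add)
  moreover have "(norm (- w + J h))\<^sup>2 = (norm w)\<^sup>2 + (norm (J h))\<^sup>2" for h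
    using w[OF span_base, of "J h"]
    by (simp add: power2_norm_eq_inner inner_simps orthogonal_def inner_commute)
  moreover have "J 0 = 0" using assms by (rule linear_0)
  ultimately show ?thesis
    by (intro that[of "x0 + d"]) (simp add: rw)
qed

text \<open>Injectivity of J gives |J y| \<ge> a |y|, hence Gaussian decay and finite first moments.
  After centring at z the first moment is odd and vanishes, so the mean is z.\<close>

lemma mean_of_gaussian:
  fixes J :: "real^'n \<Rightarrow> 'b::euclidean_space" and T :: "real^'n \<Rightarrow> 'c::{banach, second_countable_topology}"
  assumes J: "linear J" "inj J" and c: "c > 0" and T: "bounded_linear T"
    and f: "\<And>x. f x = c * exp (- (1/2) * (norm (J (x - z)))\<^sup>2)"
  shows "integral\<^sup>L lborel f > 0" "(\<integral>x. (f x / integral\<^sup>L lborel f) *\<^sub>R T x \<partial>lborel) = T z"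
proof -
  define e where "e y = exp (- (1/2) * (norm (J y))\<^sup>2)" for y
  obtain a where a: "a > 0" "\<And>x. a * norm x \<le> norm (J x)"
    using linear_inj_bounded_below_pos[OF J] by blast
  have [measurable]: "J \<in> borel_measurable borel"
    by (intro borel_measurable_continuous_onI linear_continuous_on) (simp add: J flip: linear_conv_bounded_linear)
  have [measurable]: "e \<in> borel_measurable borel"
    unfolding e_def by measurable
  have spd: "spd (a\<^sup>2 *\<^sub>R mat 1 :: real^'n^'n)"
    using a(1) by (intro spd_scaleR spd_mat_1) simp
  have e_le: "e y \<le> exp (- (1/2) * (y \<bullet> ((a\<^sup>2 *\<^sub>R mat 1) *v y)))" for y
    using power_mono[OF a(2)[of y], of 2] a(1)
    by (simp add: e_def power_mult_distrib power2_norm_eq_inner flip: scaleR_matrix_vector_assoc)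
  have int_e: "integrable lborel e"
  proof (rule integrable_gauss_quadratic[OF spd, where a = 1])
    fix y
    have "e y \<le> (1 + (norm y)\<^sup>2) * exp (- (1/2) * (y \<bullet> ((a\<^sup>2 *\<^sub>R mat 1) *v y)))"
      using mult_mono[OF _ e_le[of y], of 1 "1 + (norm y)\<^sup>2"] by (simp add: e_def)
    then show "norm (e y) \<le> 1 * (1 + (norm y)\<^sup>2) * exp (- (1/2) * (y \<bullet> ((a\<^sup>2 *\<^sub>R mat 1) *v y)))"
      by (simp add: e_def)
  qed measurable
  have int_ey: "integrable lborel (\<lambda>y. e y *\<^sub>R y)"
  proof (rule integrable_gauss_quadratic[OF spd, where a = 1])
    fix y :: "real^'n"
    have "e y * norm y \<le> exp (- (1/2) * (y \<bullet> ((a\<^sup>2 *\<^sub>R mat 1) *v y))) * (1 + (norm y)\<^sup>2)"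
      by (intro mult_mono e_le norm_le_one_plus_square) auto
    then show "norm (e y *\<^sub>R y) \<le> 1 * (1 + (norm y)\<^sup>2) * exp (- (1/2) * (y \<bullet> ((a\<^sup>2 *\<^sub>R mat 1) *v y)))"
      by (simp add: e_def mult.commute)
  qed measurable
  define E where "E = integral\<^sup>L lborel e"
  have "E > 0"
    unfolding E_def using int_e by (intro integral_lborel_pos) (simp_all add: e_def)
  have odd: "(\<integral>y. e y *\<^sub>R y \<partial>lborel) = 0"
    by (rule integral_lborel_odd) (simp_all add: e_def linear_neg J(1))
  have f': "f = (\<lambda>x. c * e (x - z))"
    using f by (auto simp: e_def)
  have intf: "integral\<^sup>L lborel f = c * E"
    unfolding f' E_def using integral_lborel_translate(1)[of e z] by simp
  then show "integral\<^sup>L lborel f > 0" using c \<open>E > 0\<close> by simp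
  have shift: "integrable lborel (\<lambda>x. e (x - z))" "(\<integral>x. e (x - z) \<partial>lborel) = E"
    "integrable lborel (\<lambda>x. e (x - z) *\<^sub>R (x - z))" "(\<integral>x. e (x - z) *\<^sub>R (x - z) \<partial>lborel) = 0"
    using integral_lborel_translate[of e z] integral_lborel_translate[of "\<lambda>y. e y *\<^sub>R y" z] int_e int_ey odd
    by (simp_all add: E_def)
  have split: "(f x / integral\<^sup>L lborel f) *\<^sub>R x = (1 / E) *\<^sub>R (e (x - z) *\<^sub>R (x - z) + e (x - z) *\<^sub>R z)" for x
    unfolding intf unfolding f' using c by (simp add: scaleR_diff_right)
  have "integrable lborel (\<lambda>x. (f x / integral\<^sup>L lborel f) *\<^sub>R x)"
    unfolding split using shift
    by (intro integrable_scaleR_right Bochner_Integration.integrable_add integrable_scaleR_left)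
  moreover have "(\<integral>x. (f x / integral\<^sup>L lborel f) *\<^sub>R x \<partial>lborel) = z"
    unfolding split using shift \<open>E > 0\<close> by simp
  \<comment> \<open>A bounded linear map commutes with the integral; T will be the projection to one
    block.\<close>
  ultimately have "(\<integral>x. T ((f x / integral\<^sup>L lborel f) *\<^sub>R x) \<partial>lborel) = T z"
    using integral_bounded_linear[OF T] by metis
  then show "(\<integral>x. (f x / integral\<^sup>L lborel f) *\<^sub>R T x \<partial>lborel) = T z"
    by (simp add: linear_simps[OF T])
qed

section \<open>Gauss--Newton smoothing\<close>

text \<open>Marginalising commutes with taking means: the mean of the image law is the integral of
  the block over the joint posterior, so the centre of the completed square can be read off block by
  block.\<close>

lemma smoothed_mean_eq:
  fixes J :: "real^('k::finite \<times> 'dx::finite) \<Rightarrow> 'b::euclidean_space"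
  assumes J: "linear J" "inj J" and "c > 0"
    and f: "\<And>x. joint_density K tm M A E y xh x = c * exp (- (1/2) * (norm (J (x - z)))\<^sup>2)"
  shows "smoothed_mean K tm M A E y xh k = block tm z k"
proof -
  let ?f = "joint_density K tm M A E y xh"
  have [measurable]: "J \<in> borel_measurable borel"
    by (intro borel_measurable_continuous_onI linear_continuous_on) (simp add: J flip: linear_conv_bounded_linear)
  have [measurable]: "?f \<in> borel_measurable borel"
    unfolding f[abs_def] by measurable
  have [measurable]: "(\<lambda>x. block tm x k) \<in> borel_measurable borel"
    by (intro borel_measurable_continuous_onI linear_continuous_on bounded_linear_block)
  note mean = mean_of_gaussian[OF J \<open>c > 0\<close> bounded_linear_block f]
  have "smoothed_mean K tm M A E y xh k = (\<integral>x. block tm x k \<partial>posterior K tm M A E y xh)"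
    unfolding smoothed_mean_def smoothed_marginal_def
    by (rule integral_distr) (simp_all add: posterior_def)
  also have "\<dots> = (\<integral>x. (?f x / integral\<^sup>L lborel ?f) *\<^sub>R block tm x k \<partial>lborel)"
    unfolding posterior_def using mean(1) \<open>c > 0\<close> by (intro integral_density) (auto simp: f)
  also have "\<dots> = block tm z k" by (rule mean(2))
  finally show ?thesis .
qed

text \<open>The common form of both smoothers: a linearisation qualifies when it is tangent to the
  predictions u and v at the current blocks, whatever produced it.\<close>

lemma gauss_newton_smoothing:
  fixes tm :: "nat \<Rightarrow> 'k::finite" and M :: "('dx::finite, 'dy::finite) ssm"
  assumes bij: "bij_betw tm {1..K} UNIV"
    and P0: "spd (init_cov M)"
    and Q: "\<And>k. k \<in> {1..<K} \<Longrightarrow> spd (motion_cov M k)" "\<And>k. k \<in> {1..<K} \<Longrightarrow> psd (lin_Omega A k)"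
    and R: "\<And>k. k \<in> {1..K} \<Longrightarrow> spd (obs_cov M k)" "\<And>k. k \<in> {1..K} \<Longrightarrow> psd (lin_Gamma A k)"
    and S: "\<And>k. k \<in> {1..K} \<Longrightarrow> spd (S k)" and lam: "lam > 0"
    and Qc: "\<And>k. k \<in> {1..<K} \<Longrightarrow> Qc k = motion_cov M k + lin_Omega A k"
    and Rc: "\<And>k. k \<in> {1..K} \<Longrightarrow> Rc k = obs_cov M k + lin_Gamma A k"
    and u: "\<And>k. k \<in> {1..<K} \<Longrightarrow> (u k has_derivative (*v) (lin_F A k)) (at (block tm xh k))"
    and b: "\<And>k. k \<in> {1..<K} \<Longrightarrow> lin_b A k = u k (block tm xh k) - lin_F A k *v block tm xh k"
    and v: "\<And>k. k \<in> {1..K} \<Longrightarrow> (v k has_derivative (*v) (lin_H A k)) (at (block tm xh k))"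
    and c: "\<And>k. k \<in> {1..K} \<Longrightarrow> lin_c A k = v k (block tm xh k) - lin_H A k *v block tm xh k"
    and W0: "W0 ** transpose W0 = matrix_inv (init_cov M)"
    and WQ: "\<And>k. k \<in> {1..<K} \<Longrightarrow> WQ k ** transpose (WQ k) = matrix_inv (Qc k)"
    and WR: "\<And>k. k \<in> {1..K} \<Longrightarrow> WR k ** transpose (WR k) = matrix_inv (Rc k)"
    and WS: "WS ** transpose WS = lam *\<^sub>R matrix_inv (block_diag K tm S)"
  shows "gauss_newton_output
    (L_LM K tm (smoothing_cost K tm (init_mean M) (init_cov M) u Qc v Rc y) lam S xh)
    (lm_residual K tm (init_mean M) W0 u WQ v WR y WS xh)
    xh (stack K tm (smoothed_mean K tm M A (\<lambda>k. (1 / lam) *\<^sub>R S k) y (block tm xh)))"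
proof -
  have residual: "L_LM K tm (smoothing_cost K tm (init_mean M) (init_cov M) u' Qc v' Rc y) lam S xh x
      = 1/2 * (norm (lm_residual K tm (init_mean M) W0 u' WQ v' WR y WS xh x))\<^sup>2" for u' v' x
    by (intro L_LM_residual bij S W0 WQ WR WS)
  let ?rho = "lm_residual K tm (init_mean M) W0 u WQ v WR y WS xh"
  obtain J where J: "(?rho has_derivative J) (at xh)"
    and affine: "\<And>x. lm_residual K tm (init_mean M) W0 (\<lambda>k z. lin_F A k *v z + lin_b A k) WQ
        (\<lambda>k z. lin_H A k *v z + lin_c A k) WR y WS xh x = ?rho xh + J (x - xh)"
    and J_reg: "\<And>h. snd (snd (snd (J h))) = transpose WS *v h"
    using lm_residual_linearised[OF bij, of u "lin_F A" xh "lin_b A" v "lin_H A" "lin_c A"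
        "init_mean M" W0 WQ WR y WS] u b v c by blast
  have "linear J" using J by (rule has_derivative_linear)
  \<comment> \<open>The last component of J h has squared norm lam times the regularising form of h.
    If it vanishes, definiteness kills every block of h.\<close>
  have "inj J"
  proof (subst linear_injective_0[OF \<open>linear J\<close>], intro allI impI)
    fix h
    assume "J h = 0"
    then have "transpose WS *v h = 0" using J_reg[of h] by simp
    then have "lam * (h \<bullet> (matrix_inv (block_diag K tm S) *v h)) = 0"
      using root_norm[OF WS, of h] by (simp flip: scaleR_matrix_vector_assoc)
    then have "(\<Sum>k\<in>{1..K}. block tm h k \<bullet> (matrix_inv (S k) *v block tm h k)) = 0"
      using lam by (subst inner_block_diag_inv[OF bij, symmetric]) (auto simp: S)
    moreover have "0 \<le> block tm h k \<bullet> (matrix_inv (S k) *v block tm h k)" if "k \<in> {1..K}" for k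
      using spd_imp_psd[OF spd_matrix_inv[OF S[OF that]]] by (simp add: psd_def)
    ultimately have "block tm h k \<bullet> (matrix_inv (S k) *v block tm h k) = 0" if "k \<in> {1..K}" for k
      using that by (subst (asm) sum_nonneg_eq_0_iff) auto
    then have "block tm h k = 0" if "k \<in> {1..K}" for k
      using spd_matrix_inv[OF S[OF that]] that unfolding spd_def by (metis less_irrefl)
    then show "h = 0"
      by (intro block_eqI[OF bij]) (simp add: block_def vec_eq_iff)
  qed
  obtain z where z: "\<And>x. (norm (?rho xh + J (x - xh)))\<^sup>2
      = (norm (?rho xh + J (z - xh)))\<^sup>2 + (norm (J (x - z)))\<^sup>2"
    using least_squares_solution[OF \<open>linear J\<close>] by blast
  have "\<exists>c>0. \<forall>x. joint_density K tm M A (\<lambda>k. (1 / lam) *\<^sub>R S k) y (block tm xh) x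
      = c * exp (- L_LM K tm (smoothing_cost K tm (init_mean M) (init_cov M)
        (\<lambda>k z. lin_F A k *v z + lin_b A k) Qc (\<lambda>k z. lin_H A k *v z + lin_c A k) Rc y) lam S xh x)"
    by (intro joint_density_proportional bij P0 Q R S lam Qc Rc)
  then obtain c0 where c0: "c0 > 0"
    "\<And>x. joint_density K tm M A (\<lambda>k. (1 / lam) *\<^sub>R S k) y (block tm xh) x
      = c0 * exp (- L_LM K tm (smoothing_cost K tm (init_mean M) (init_cov M)
        (\<lambda>k z. lin_F A k *v z + lin_b A k) Qc (\<lambda>k z. lin_H A k *v z + lin_c A k) Rc y) lam S xh x)"
    by blast
  \<comment> \<open>The exponentiated minimum of the Gauss-Newton model is absorbed into the
    constant, leaving a pure square around z.\<close>
  define c1 where "c1 = c0 * exp (- (1/2) * (norm (?rho xh + J (z - xh)))\<^sup>2)"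
  have "joint_density K tm M A (\<lambda>k. (1 / lam) *\<^sub>R S k) y (block tm xh) x
      = c1 * exp (- (1/2) * (norm (J (x - z)))\<^sup>2)" for x
  proof -
    have "- L_LM K tm (smoothing_cost K tm (init_mean M) (init_cov M)
        (\<lambda>k z. lin_F A k *v z + lin_b A k) Qc (\<lambda>k z. lin_H A k *v z + lin_c A k) Rc y) lam S xh x
      = - (1/2) * (norm (?rho xh + J (z - xh)))\<^sup>2 + - (1/2) * (norm (J (x - z)))\<^sup>2"
      unfolding residual affine z[of x] by (simp add: field_simps)
    then show ?thesis
      unfolding c0(2) c1_def by (simp only: exp_add mult.assoc)
  qed
  moreover have "c1 > 0" using c0(1) by (simp add: c1_def)
  ultimately have "smoothed_mean K tm M A (\<lambda>k. (1 / lam) *\<^sub>R S k) y (block tm xh) = block tm z"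
    using smoothed_mean_eq[OF \<open>linear J\<close> \<open>inj J\<close>] by blast
  then have mean: "stack K tm (smoothed_mean K tm M A (\<lambda>k. (1 / lam) *\<^sub>R S k) y (block tm xh)) = z"
    by (simp only: stack_block[OF bij])
  have model: "gn_model ?rho xh x = 1/2 * (norm (?rho xh + J (x - xh)))\<^sup>2" for x
    unfolding gn_model_def frechet_derivative_at[OF J, symmetric] ..
  have "gn_model ?rho xh z < gn_model ?rho xh x" if "x \<noteq> z" for x
  proof -
    have "J (x - z) \<noteq> 0"
      using that \<open>inj J\<close> linear_injective_0[OF \<open>linear J\<close>] by auto
    then show ?thesis unfolding model z[of x] by simp
  qed
  moreover have "?rho differentiable (at xh)"
    using J unfolding differentiable_def by blast
  ultimately show ?thesis
    unfolding gauss_newton_output_def mean using residual by blast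
qed

theorem proposition4p3:
  fixes K :: nat and tm :: "nat \<Rightarrow> 'k::finite"
    and M :: "('dx::finite, 'dy::finite) ssm"
    and y :: "nat \<Rightarrow> real^'dy"
    and lam :: real and S :: "nat \<Rightarrow> real^'dx^'dx"
    and xh :: "real^('k \<times> 'dx)"
    and Ph :: "nat \<Rightarrow> real^'dx^'dx"
  assumes "bij_betw tm {1..K} UNIV"
    and "spd (init_cov M)"
    and "\<And>k. k \<in> {1..<K} \<Longrightarrow> spd (motion_cov M k)"
    and "\<And>k. k \<in> {1..K} \<Longrightarrow> spd (obs_cov M k)"
    and "lam > 0"
    and "\<And>k. k \<in> {1..K} \<Longrightarrow> spd (S k)"
  shows
    "((\<forall>k\<in>{1..<K}. \<forall>x. motion M k differentiable (at x)) \<and>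
      (\<forall>k\<in>{1..K}. \<forall>x. obs M k differentiable (at x))
      \<longrightarrow> (\<forall>W0 WQ WR WS.
            W0 ** transpose W0 = matrix_inv (init_cov M) \<and>
            (\<forall>k\<in>{1..<K}. WQ k ** transpose (WQ k) = matrix_inv (motion_cov M k)) \<and>
            (\<forall>k\<in>{1..K}. WR k ** transpose (WR k) = matrix_inv (obs_cov M k)) \<and>
            WS ** transpose WS = lam *\<^sub>R matrix_inv (block_diag K tm S)
            \<longrightarrow> gauss_newton_output
                  (L_LM K tm (L_IEKS K tm M y) lam S xh)
                  (lm_residual K tm (init_mean M) W0 (motion M) WQ (obs M) WR y WS xh)
                  xh (ieks_means K tm M y lam S xh)))
     \<and>
     ((\<forall>k\<in>{1..K}. spd (Ph k)) \<and>
      (\<forall>k\<in>{1..<K}. slr_moments_finite (motion M k) (Ph k)) \<and>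
      (\<forall>k\<in>{1..K}. slr_moments_finite (obs M k) (Ph k))
      \<longrightarrow> (\<forall>W0 WQ WR WS.
            W0 ** transpose W0 = matrix_inv (init_cov M) \<and>
            (\<forall>k\<in>{1..<K}. WQ k ** transpose (WQ k) =
               matrix_inv (motion_cov M k + slr_cov (motion M k) (Ph k) (block tm xh k))) \<and>
            (\<forall>k\<in>{1..K}. WR k ** transpose (WR k) =
               matrix_inv (obs_cov M k + slr_cov (obs M k) (Ph k) (block tm xh k))) \<and>
            WS ** transpose WS = lam *\<^sub>R matrix_inv (block_diag K tm S)
            \<longrightarrow> gauss_newton_output
                  (L_LM K tm (L_IPLS K tm M y xh Ph) lam S xh)
                  (lm_residual K tm (init_mean M) W0 (\<lambda>k. slr_mean (motion M k) (Ph k)) WQ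
                     (\<lambda>k. slr_mean (obs M k) (Ph k)) WR y WS xh)
                  xh (ipls_means K tm M y lam S xh Ph)))"
proof (intro conjI impI allI; elim conjE)
  fix W0 :: "real^'dx^'dx" and WQ :: "nat \<Rightarrow> real^'dx^'dx" and WR :: "nat \<Rightarrow> real^'dy^'dy"
    and WS :: "real^('k \<times> 'dx)^('k \<times> 'dx)"
  assume "\<forall>k\<in>{1..<K}. \<forall>x. motion M k differentiable (at x)"
    and "\<forall>k\<in>{1..K}. \<forall>x. obs M k differentiable (at x)"
    and "W0 ** transpose W0 = matrix_inv (init_cov M)"
    and "\<forall>k\<in>{1..<K}. WQ k ** transpose (WQ k) = matrix_inv (motion_cov M k)"
    and "\<forall>k\<in>{1..K}. WR k ** transpose (WR k) = matrix_inv (obs_cov M k)"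
    and "WS ** transpose WS = lam *\<^sub>R matrix_inv (block_diag K tm S)"
  \<comment> \<open>The surrogate covariances are zero, so the summed covariances are those of the
    noises; the Jacobians supply the derivatives.\<close>
  with assms show "gauss_newton_output
      (L_LM K tm (L_IEKS K tm M y) lam S xh)
      (lm_residual K tm (init_mean M) W0 (motion M) WQ (obs M) WR y WS xh)
      xh (ieks_means K tm M y lam S xh)"
    unfolding L_IEKS_def ieks_means_def
    by (intro gauss_newton_smoothing) (simp_all add: ieks_linearisation_def psd_zero flip: jacobian_works)
next
  fix W0 :: "real^'dx^'dx" and WQ :: "nat \<Rightarrow> real^'dx^'dx" and WR :: "nat \<Rightarrow> real^'dy^'dy"
    and WS :: "real^('k \<times> 'dx)^('k \<times> 'dx)"
  assume "\<forall>k\<in>{1..K}. spd (Ph k)"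
    and "\<forall>k\<in>{1..<K}. slr_moments_finite (motion M k) (Ph k)"
    and "\<forall>k\<in>{1..K}. slr_moments_finite (obs M k) (Ph k)"
    and "W0 ** transpose W0 = matrix_inv (init_cov M)"
    and "\<forall>k\<in>{1..<K}. WQ k ** transpose (WQ k) =
               matrix_inv (motion_cov M k + slr_cov (motion M k) (Ph k) (block tm xh k))"
    and "\<forall>k\<in>{1..K}. WR k ** transpose (WR k) =
               matrix_inv (obs_cov M k + slr_cov (obs M k) (Ph k) (block tm xh k))"
    and "WS ** transpose WS = lam *\<^sub>R matrix_inv (block_diag K tm S)"
  \<comment> \<open>The predictions are Gaussian means. Once \<open>slr_mat\<close> is known to be
    their derivative, \<open>slr_offset\<close> is by definition the offset of their
    tangent.\<close>
  with assms show "gauss_newton_output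
      (L_LM K tm (L_IPLS K tm M y xh Ph) lam S xh)
      (lm_residual K tm (init_mean M) W0 (\<lambda>k. slr_mean (motion M k) (Ph k)) WQ
         (\<lambda>k. slr_mean (obs M k) (Ph k)) WR y WS xh)
      xh (ipls_means K tm M y lam S xh Ph)"
    unfolding L_IPLS_def ipls_means_def
    by (intro gauss_newton_smoothing)
      (simp_all add: ipls_linearisation_def slr_offset_def slr_cov_psd slr_mean_has_derivative)
qed

end
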